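(* For $X\in\mathsf{sSet}$, vertices $x_0,x_1\colon\Delta^0\to X$, and $W\in\{L,R\}$, there is a natural isomorphism of cubical sets $U\,\mathrm{Hom}_X(x_0,x_1)\cong\mathrm{Map}^W_{UX}(x_0,x_1)$.
   Context: Cubical sets. $\Box$ is the category whose objects are the posets $[1]^n=\{0\le 1\}^n$, $n\ge 0$, and whose morphisms are generated (inside posets) under composition by: faces $\partial_{i,\varepsilon}\colon[1]^{n-1}\to[1]^n$ (insert $\varepsilon\in\{0,1\}$ as $i$-th coordinate); degeneracies $\sigma_i\colon[1]^n\to[1]^{n-1}$ (omit the $i$-th coordinate); negative connections $\gamma_{i,0}\colon[1]^n\to[1]^{n-1}$ (replace $x_i,x_{i+1}$ by their maximum) and positive connections $\gamma_{i,1}$ (replace them by their minimum). $\mathsf{cSet}=\mathsf{Set}^{\Box^{\mathrm{op}}}$; $\Box^n$ is the representable at $[1]^n$; operators act on the right. $T\colon\mathsf{cSet}\to\mathsf{sSet}$ (triangulation) is the colimit-preserving functor with $T\Box^n=(\Delta^1)^n$, the nerve of $[1]^n$; its right adjoint $U\colon\mathsf{sSet}\to\mathsf{cSet}$ is $(UX)_n=\mathsf{sSet}((\Delta^1)^n,X)$. In particular $X$ and $UX$ have the same vertices. For a cubical set $Y$ with vertices $y_0,y_1$, the right mapping space $\mathrm{Map}^R_Y(y_0,y_1)$ is the cubical set whose $n$-cubes are the $(n+1)$-cubes $s$ of $Y$ with $s\partial_{n+1,\varepsilon}=y_\varepsilon$ for $\varepsilon=0,1$, with operators of $Y$ acting on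 the first $n$ coordinates. The left mapping space $\mathrm{Map}^L_Y(y_0,y_1)$ has as $n$-cubes the $(n+1)$-cubes $s$ of $Y$ with $s\partial_{1,\varepsilon}=y_\varepsilon$ for $\varepsilon=0,1$, with operators of $Y$ acting on the last $n$ coordinates. (Here $y_\varepsilon$ also denotes the degenerate cube on it.) For a simplicial set $X$ with vertices $x_0,x_1$, $\mathrm{Hom}_X(x_0,x_1)$ is the pullback of $\Delta^0\xrightarrow{(x_0,x_1)}X^{\partial\Delta^1}\leftarrow X^{\Delta^1}$. *)

theory Defs
  imports Main "HOL-Library.FuncSet"
begin

section \<open>Presheaves on concrete categories indexed by the natural numbers\<close>

text \<open>
  Both \<open>\<Delta>\<close> and \<open>\<box>\<close> have one object for every natural number \<open>n\<close>, and their
  morphisms are functions between underlying sets \<open>Ob C n\<close>. A function on a set is always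
  represented by its extensional representative (value \<open>undefined\<close> outside of the set), so that
  equality of morphisms is equality in HOL.
\<close>

record 'p ccat =
  Ob :: "nat \<Rightarrow> 'p set"
  Mor :: "nat \<Rightarrow> nat \<Rightarrow> ('p \<Rightarrow> 'p) set"

text \<open>\<open>act X m n f\<close> is the right action \<open>x \<mapsto> x f\<close> of \<open>f \<in> Mor C m n\<close>, from level \<open>n\<close> to level \<open>m\<close>.\<close>

record ('p, 'a) psh =
  el :: "nat \<Rightarrow> 'a set"
  act :: "nat \<Rightarrow> nat \<Rightarrow> ('p \<Rightarrow> 'p) \<Rightarrow> 'a \<Rightarrow> 'a"

definition presheaf :: "'p ccat \<Rightarrow> ('p, 'a) psh \<Rightarrow> bool" where
  "presheaf C X \<longleftrightarrow>
     (\<forall>m n. \<forall>f \<in> Mor C m n. \<forall>x \<in> el X n. act X m n f x \<in> el X m) \<and>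
     (\<forall>n. \<forall>x \<in> el X n. act X n n (\<lambda>p\<in>Ob C n. p) x = x) \<and>
     (\<forall>k m n. \<forall>f \<in> Mor C k m. \<forall>g \<in> Mor C m n. \<forall>x \<in> el X n.
        act X k n (compose (Ob C k) g f) x = act X k m f (act X m n g x))"

definition psh_hom ::
  "'p ccat \<Rightarrow> ('p, 'a) psh \<Rightarrow> ('p, 'b) psh \<Rightarrow> (nat \<Rightarrow> 'a \<Rightarrow> 'b) set" where
  "psh_hom C X Y = {\<phi>.
     (\<forall>n. \<phi> n \<in> el X n \<rightarrow>\<^sub>E el Y n) \<and>
     (\<forall>m n. \<forall>f \<in> Mor C m n. \<forall>x \<in> el X n. \<phi> m (act X m n f x) = act Y m n f (\<phi> n x))}"

definition psh_id :: "('p, 'a) psh \<Rightarrow> nat \<Rightarrow> 'a \<Rightarrow> 'a" where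
  "psh_id X n = (\<lambda>x\<in>el X n. x)"

text \<open>Composition \<open>\<psi> \<circ> \<phi>\<close>, where \<open>X\<close> is the source of \<open>\<phi>\<close>.\<close>

definition psh_comp ::
  "('p, 'a) psh \<Rightarrow> (nat \<Rightarrow> 'b \<Rightarrow> 'c) \<Rightarrow> (nat \<Rightarrow> 'a \<Rightarrow> 'b) \<Rightarrow> nat \<Rightarrow> 'a \<Rightarrow> 'c" where
  "psh_comp X \<psi> \<phi> n = compose (el X n) (\<psi> n) (\<phi> n)"

definition psh_iso ::
  "'p ccat \<Rightarrow> ('p, 'a) psh \<Rightarrow> ('p, 'b) psh \<Rightarrow> (nat \<Rightarrow> 'a \<Rightarrow> 'b) \<Rightarrow> bool" where
  "psh_iso C X Y \<phi> \<longleftrightarrow> presheaf C X \<and> presheaf C Y \<and> \<phi> \<in> psh_hom C X Y \<and>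
     (\<exists>\<psi> \<in> psh_hom C Y X. psh_comp X \<psi> \<phi> = psh_id X \<and> psh_comp Y \<phi> \<psi> = psh_id Y)"

definition psh_prod :: "('p, 'a) psh \<Rightarrow> ('p, 'b) psh \<Rightarrow> ('p, 'a \<times> 'b) psh" where
  "psh_prod X Y =
     \<lparr> el = (\<lambda>n. el X n \<times> el Y n),
       act = (\<lambda>m n f (x, y). (act X m n f x, act Y m n f y)) \<rparr>"

definition psh_pullback ::
  "('p, 'a) psh \<Rightarrow> ('p, 'b) psh \<Rightarrow> (nat \<Rightarrow> 'a \<Rightarrow> 'c) \<Rightarrow> (nat \<Rightarrow> 'b \<Rightarrow> 'c) \<Rightarrow> ('p, 'a \<times> 'b) psh" where
  "psh_pullback A B f g =
     \<lparr> el = (\<lambda>n. {(a, b). a \<in> el A n \<and> b \<in> el B n \<and> f n a = g n b}),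
       act = (\<lambda>m n h (a, b). (act A m n h a, act B m n h b)) \<rparr>"


section \<open>Simplicial sets\<close>

definition mono_maps :: "nat \<Rightarrow> 'p set \<Rightarrow> ('p \<Rightarrow> 'p \<Rightarrow> bool) \<Rightarrow> (nat \<Rightarrow> 'p) set" where
  "mono_maps k P le = {s \<in> {..k} \<rightarrow>\<^sub>E P. \<forall>i j. i \<le> j \<and> j \<le> k \<longrightarrow> le (s i) (s j)}"

definition Simp_cat :: "nat ccat" where
  "Simp_cat = \<lparr> Ob = (\<lambda>n. {..n}), Mor = (\<lambda>m n. mono_maps m {..n} (\<le>)) \<rparr>"

type_synonym 'a sset = "(nat, 'a) psh"

definition nerve :: "'p set \<Rightarrow> ('p \<Rightarrow> 'p \<Rightarrow> bool) \<Rightarrow> (nat \<Rightarrow> 'p) sset" where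
  "nerve P le =
     \<lparr> el = (\<lambda>k. mono_maps k P le), act = (\<lambda>m n f s. compose {..m} s f) \<rparr>"

definition nerve_map ::
  "'p set \<Rightarrow> ('p \<Rightarrow> 'p \<Rightarrow> bool) \<Rightarrow> ('p \<Rightarrow> 'q) \<Rightarrow> nat \<Rightarrow> (nat \<Rightarrow> 'p) \<Rightarrow> (nat \<Rightarrow> 'q)" where
  "nerve_map P le h k = (\<lambda>s \<in> el (nerve P le) k. compose {..k} h s)"

definition simplex :: "nat \<Rightarrow> (nat \<Rightarrow> nat) sset" where
  "simplex n = nerve {..n} (\<le>)"

definition bdry_simplex :: "nat \<Rightarrow> (nat \<Rightarrow> nat) sset" where
  "bdry_simplex n =
     \<lparr> el = (\<lambda>k. {s \<in> el (simplex n) k. s ` {..k} \<noteq> {..n}}), act = act (simplex n) \<rparr>"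

text \<open>The cotensor \<open>X\<^sup>K\<close> has \<open>n\<close>-simplices the simplicial maps \<open>\<Delta>\<^sup>n \<times> K \<rightarrow> X\<close>.\<close>

definition sset_exp :: "'a sset \<Rightarrow> 'b sset \<Rightarrow> (nat \<Rightarrow> (nat \<Rightarrow> nat) \<times> 'b \<Rightarrow> 'a) sset" where
  "sset_exp X K =
     \<lparr> el = (\<lambda>n. psh_hom Simp_cat (psh_prod (simplex n) K) X),
       act = (\<lambda>m n f \<phi>. \<lambda>k. \<lambda>(a, b) \<in> el (psh_prod (simplex m) K) k.
                \<phi> k (nerve_map {..m} (\<le>) f k a, b)) \<rparr>"

text \<open>The map \<open>X\<^sup>K \<rightarrow> X\<^sup>L\<close> given by restriction along the inclusion of a subcomplex \<open>L \<subseteq> K\<close>.\<close>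

definition exp_restrict ::
  "'a sset \<Rightarrow> 'b sset \<Rightarrow> 'b sset \<Rightarrow>
     nat \<Rightarrow> (nat \<Rightarrow> (nat \<Rightarrow> nat) \<times> 'b \<Rightarrow> 'a) \<Rightarrow> (nat \<Rightarrow> (nat \<Rightarrow> nat) \<times> 'b \<Rightarrow> 'a)" where
  "exp_restrict X K L n =
     (\<lambda>\<phi> \<in> el (sset_exp X K) n. \<lambda>k. restrict (\<phi> k) (el (psh_prod (simplex n) L) k))"

text \<open>Vertices of \<open>X\<close> are simplicial maps \<open>\<Delta>\<^sup>0 \<rightarrow> X\<close>.\<close>

definition sset_vertices :: "'a sset \<Rightarrow> (nat \<Rightarrow> (nat \<Rightarrow> nat) \<Rightarrow> 'a) set" where
  "sset_vertices X = psh_hom Simp_cat (simplex 0) X"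

text \<open>
  The map \<open>(x\<^sub>0, x\<^sub>1): \<Delta>\<^sup>0 \<rightarrow> X\<^bsup>\<partial>\<Delta>\<^sup>1\<^esup>\<close>. Its transpose \<open>\<Delta>\<^sup>0 \<times> \<partial>\<Delta>\<^sup>1 \<rightarrow> X\<close> is \<open>x\<^sub>0\<close> on \<open>\<Delta>\<^sup>0 \<times> {0}\<close> and
  \<open>x\<^sub>1\<close> on \<open>\<Delta>\<^sup>0 \<times> {1}\<close>. A simplex \<open>b\<close> of \<open>\<partial>\<Delta>\<^sup>1\<close> is constant, so \<open>b 0\<close> tells in which component it lies.
\<close>

definition vertex_pair ::
  "'a sset \<Rightarrow> (nat \<Rightarrow> (nat \<Rightarrow> nat) \<Rightarrow> 'a) \<Rightarrow> (nat \<Rightarrow> (nat \<Rightarrow> nat) \<Rightarrow> 'a) \<Rightarrow>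
     nat \<Rightarrow> (nat \<Rightarrow> nat) \<Rightarrow> (nat \<Rightarrow> (nat \<Rightarrow> nat) \<times> (nat \<Rightarrow> nat) \<Rightarrow> 'a)" where
  "vertex_pair X x0 x1 n =
     (\<lambda>t \<in> el (simplex 0) n. \<lambda>k. \<lambda>(a, b) \<in> el (psh_prod (simplex n) (bdry_simplex 1)) k.
        (if b 0 = 0 then x0 else x1) k (act (simplex 0) k n a t))"

type_synonym 'a hom_el = "(nat \<Rightarrow> nat) \<times> (nat \<Rightarrow> (nat \<Rightarrow> nat) \<times> (nat \<Rightarrow> nat) \<Rightarrow> 'a)"

definition Hom_sset ::
  "'a sset \<Rightarrow> (nat \<Rightarrow> (nat \<Rightarrow> nat) \<Rightarrow> 'a) \<Rightarrow> (nat \<Rightarrow> (nat \<Rightarrow> nat) \<Rightarrow> 'a) \<Rightarrow> 'a hom_el sset" where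
  "Hom_sset X x0 x1 =
     psh_pullback (simplex 0) (sset_exp X (simplex 1))
       (vertex_pair X x0 x1) (exp_restrict X (simplex 1) (bdry_simplex 1))"

text \<open>The map \<open>Hom\<^sub>X(x\<^sub>0, x\<^sub>1) \<rightarrow> Hom\<^sub>Y(g x\<^sub>0, g x\<^sub>1)\<close> induced by \<open>g: X \<rightarrow> Y\<close>.\<close>

definition Hom_sset_map ::
  "'a sset \<Rightarrow> (nat \<Rightarrow> (nat \<Rightarrow> nat) \<Rightarrow> 'a) \<Rightarrow> (nat \<Rightarrow> (nat \<Rightarrow> nat) \<Rightarrow> 'a) \<Rightarrow> (nat \<Rightarrow> 'a \<Rightarrow> 'b) \<Rightarrow>
     nat \<Rightarrow> 'a hom_el \<Rightarrow> 'b hom_el" where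
  "Hom_sset_map X x0 x1 g n =
     (\<lambda>(t, \<phi>) \<in> el (Hom_sset X x0 x1) n. (t, psh_comp (psh_prod (simplex n) (simplex 1)) g \<phi>))"


section \<open>Cubical sets\<close>

text \<open>
  \<open>[1]\<^sup>n\<close> is the set of lists of truth values of length \<open>n\<close> with the coordinatewise order, where
  \<open>False\<close> and \<open>True\<close> stand for 0 and 1; the \<open>i\<close>-th coordinate (counted from 1) of \<open>xs\<close> is
  \<open>xs ! (i - 1)\<close>.
\<close>

definition cube :: "nat \<Rightarrow> bool list set" where
  "cube n = {xs. length xs = n}"

abbreviation cube_le :: "bool list \<Rightarrow> bool list \<Rightarrow> bool" where
  "cube_le \<equiv> list_all2 (\<le>)"

text \<open>
  In \<open>face n i e\<close>, \<open>degen n i\<close> and \<open>conn n i e\<close> the number \<open>n\<close> is the dimension of the source cube.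
\<close>

definition face :: "nat \<Rightarrow> nat \<Rightarrow> bool \<Rightarrow> bool list \<Rightarrow> bool list" where
  "face n i e = (\<lambda>xs \<in> cube n. take (i - 1) xs @ [e] @ drop (i - 1) xs)"

definition degen :: "nat \<Rightarrow> nat \<Rightarrow> bool list \<Rightarrow> bool list" where
  "degen n i = (\<lambda>xs \<in> cube n. take (i - 1) xs @ drop i xs)"

definition conn :: "nat \<Rightarrow> nat \<Rightarrow> bool \<Rightarrow> bool list \<Rightarrow> bool list" where
  "conn n i e = (\<lambda>xs \<in> cube n. take (i - 1) xs @
     [if e then min (xs ! (i - 1)) (xs ! i) else max (xs ! (i - 1)) (xs ! i)] @ drop (i + 1) xs)"

inductive box_mor :: "nat \<Rightarrow> nat \<Rightarrow> (bool list \<Rightarrow> bool list) \<Rightarrow> bool" where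
  ident: "box_mor n n (\<lambda>xs \<in> cube n. xs)"
| face: "1 \<le> i \<Longrightarrow> i \<le> n \<Longrightarrow> box_mor (n - 1) n (face (n - 1) i e)"
| degen: "1 \<le> i \<Longrightarrow> i \<le> n \<Longrightarrow> box_mor n (n - 1) (degen n i)"
| conn: "1 \<le> i \<Longrightarrow> i + 1 \<le> n \<Longrightarrow> box_mor n (n - 1) (conn n i e)"
| comp: "box_mor k m f \<Longrightarrow> box_mor m n g \<Longrightarrow> box_mor k n (compose (cube k) g f)"

definition Box_cat :: "bool list ccat" where
  "Box_cat = \<lparr> Ob = cube, Mor = (\<lambda>m n. {f. box_mor m n f}) \<rparr>"

type_synonym 'a cset = "(bool list, 'a) psh"

text \<open>The degenerate \<open>n\<close>-cube on a vertex \<open>y\<close>, obtained from the unique map \<open>[1]\<^sup>n \<rightarrow> [1]\<^sup>0\<close>.\<close>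

definition degen_cube :: "'a cset \<Rightarrow> nat \<Rightarrow> 'a \<Rightarrow> 'a" where
  "degen_cube Y n y = act Y n 0 (\<lambda>xs \<in> cube n. []) y"

text \<open>\<open>T_cube n\<close> is \<open>T \<box>\<^sup>n = (\<Delta>\<^sup>1)\<^sup>n\<close>.\<close>

definition T_cube :: "nat \<Rightarrow> (nat \<Rightarrow> bool list) sset" where
  "T_cube n = nerve (cube n) cube_le"

type_synonym 'a U_el = "nat \<Rightarrow> (nat \<Rightarrow> bool list) \<Rightarrow> 'a"

definition U :: "'a sset \<Rightarrow> 'a U_el cset" where
  "U X =
     \<lparr> el = (\<lambda>n. psh_hom Simp_cat (T_cube n) X),
       act = (\<lambda>m n f \<phi>. psh_comp (T_cube m) \<phi> (nerve_map (cube m) cube_le f)) \<rparr>"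

definition U_map :: "'a sset \<Rightarrow> (nat \<Rightarrow> 'a \<Rightarrow> 'b) \<Rightarrow> nat \<Rightarrow> 'a U_el \<Rightarrow> 'b U_el" where
  "U_map X g n = (\<lambda>\<phi> \<in> el (U X) n. psh_comp (T_cube n) g \<phi>)"

text \<open>
  The vertex of \<open>U X\<close> that corresponds to the vertex \<open>x: \<Delta>\<^sup>0 \<rightarrow> X\<close> under \<open>(\<Delta>\<^sup>1)\<^sup>0 \<cong> \<Delta>\<^sup>0\<close>.
\<close>

definition U_vertex :: "(nat \<Rightarrow> (nat \<Rightarrow> nat) \<Rightarrow> 'a) \<Rightarrow> 'a U_el" where
  "U_vertex x = psh_comp (T_cube 0) x (nerve_map (cube 0) cube_le (\<lambda>xs \<in> cube 0. 0))"

datatype side = L | R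

fun end_face :: "side \<Rightarrow> nat \<Rightarrow> bool \<Rightarrow> bool list \<Rightarrow> bool list" where
  "end_face R n e = face n (n + 1) e"
| "end_face L n e = face n 1 e"

text \<open>\<open>f \<times> [1]\<close> resp. \<open>[1] \<times> f\<close>, for \<open>f\<close> with source \<open>[1]\<^sup>m\<close>.\<close>

fun extend_op :: "side \<Rightarrow> nat \<Rightarrow> (bool list \<Rightarrow> bool list) \<Rightarrow> bool list \<Rightarrow> bool list" where
  "extend_op R m f = (\<lambda>xs \<in> cube (m + 1). f (butlast xs) @ [last xs])"
| "extend_op L m f = (\<lambda>xs \<in> cube (m + 1). hd xs # f (tl xs))"

definition Map_cset :: "side \<Rightarrow> 'a cset \<Rightarrow> 'a \<Rightarrow> 'a \<Rightarrow> 'a cset" where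
  "Map_cset W Y y0 y1 =
     \<lparr> el = (\<lambda>n. {s \<in> el Y (n + 1).
               act Y n (n + 1) (end_face W n False) s = degen_cube Y n y0 \<and>
               act Y n (n + 1) (end_face W n True) s = degen_cube Y n y1}),
       act = (\<lambda>m n f s. act Y (m + 1) (n + 1) (extend_op W m f) s) \<rparr>"

text \<open>The map \<open>Map\<^sup>W\<^sub>Y(y\<^sub>0, y\<^sub>1) \<rightarrow> Map\<^sup>W\<^sub>Z(h y\<^sub>0, h y\<^sub>1)\<close> induced by \<open>h: Y \<rightarrow> Z\<close>.\<close>

definition Map_cset_map ::
  "side \<Rightarrow> 'a cset \<Rightarrow> 'a \<Rightarrow> 'a \<Rightarrow> (nat \<Rightarrow> 'a \<Rightarrow> 'b) \<Rightarrow> nat \<Rightarrow> 'a \<Rightarrow> 'b" where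
  "Map_cset_map W Y y0 y1 h n = restrict (h (n + 1)) (el (Map_cset W Y y0 y1) n)"

end

theory Submission
  imports Defs
begin

text \<open>
  The isomorphism is the exponential law. Fix \<open>n\<close>. By definition an \<open>n\<close>-cube of \<open>U Hom\<^sub>X(x\<^sub>0, x\<^sub>1)\<close> is
  a simplicial map \<open>(\<Delta>\<^sup>1)\<^sup>n \<rightarrow> X\<^bsup>\<Delta>\<^sup>1\<^esup>\<close> whose restriction to \<open>\<partial>\<Delta>\<^sup>1\<close> is the constant map at \<open>(x\<^sub>0, x\<^sub>1)\<close>;
  \<open>el_Hom\<close> says this simplex by simplex. Its transpose is a simplicial map \<open>(\<Delta>\<^sup>1)\<^sup>n \<times> \<Delta>\<^sup>1 \<rightarrow> X\<close> that is constant at \<open>x\<^sub>0\<close> and \<open>x\<^sub>1\<close>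
  on the two ends of the cylinder. The functor \<open>T\<close> takes \<open>\<box>\<^bsup>n+1\<^esup>\<close> to this cylinder, because the poset
  \<open>[1]\<^bsup>n+1\<^esup>\<close> is \<open>[1]\<^sup>n \<times> [1]\<close>, with the last coordinate split off for the right mapping space and the
  first one for the left mapping space. Hence the transpose is an \<open>(n+1)\<close>-cube of \<open>U X\<close>, and the
  condition on the ends says that its two outer faces are degenerate on \<open>x\<^sub>0\<close> and \<open>x\<^sub>1\<close>; this is
  \<open>el_Map\<close>. The side \<open>W\<close> enters only through the splitting, so both cases have the same proof.

  A simplex of \<open>X\<^bsup>\<Delta>\<^sup>1\<^esup>\<close> is a map \<open>\<Delta>\<^sup>k \<times> \<Delta>\<^sup>1 \<rightarrow> X\<close>, so the evaluation that defines the transpose is at the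
  universal simplex \<open>id\<close> of \<open>\<Delta>\<^sup>k\<close>: the transpose of \<open>\<Psi>\<close> takes a \<open>k\<close>-simplex \<open>(s, b)\<close> of the cylinder to
  \<open>(\<Psi> s)(id, b)\<close>, and conversely \<open>\<theta>\<close> gives the map \<open>s \<mapsto> ((a, b) \<mapsto> \<theta>(s a, b))\<close>. These are
  \<open>uncurry_cube\<close> and \<open>curry_cube\<close>. That they are inverse to each other is the Yoneda argument in
  \<open>snd_Hom_cube_restrict\<close>. Cube operators act on \<open>s\<close> alone and maps \<open>X \<rightarrow> X'\<close> act on values alone,
  which gives naturality in both variables.
\<close>

section \<open>Presheaf maps\<close>

lemma psh_homI:
  assumes "\<And>n. \<phi> n \<in> extensional (el X n)"
    and "\<And>n x. x \<in> el X n \<Longrightarrow> \<phi> n x \<in> el Y n"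
    and "\<And>m n f x. f \<in> Mor C m n \<Longrightarrow> x \<in> el X n \<Longrightarrow> \<phi> m (act X m n f x) = act Y m n f (\<phi> n x)"
  shows "\<phi> \<in> psh_hom C X Y"
  using assms by (auto simp: psh_hom_def PiE_def)

lemma psh_homD:
  assumes "\<phi> \<in> psh_hom C X Y"
  shows "\<phi> n \<in> extensional (el X n)"
    and "x \<in> el X n \<Longrightarrow> \<phi> n x \<in> el Y n"
    and "f \<in> Mor C m n \<Longrightarrow> x \<in> el X n \<Longrightarrow> \<phi> m (act X m n f x) = act Y m n f (\<phi> n x)"
  using assms by (auto simp: psh_hom_def PiE_def)

lemma psh_hom_eqI:
  assumes "\<phi> \<in> psh_hom C X Y" "\<psi> \<in> psh_hom C X Z" "\<And>n x. x \<in> el X n \<Longrightarrow> \<phi> n x = \<psi> n x"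
  shows "\<phi> = \<psi>"
proof
  fix n show "\<phi> n = \<psi> n"
    by (rule extensionalityI[OF psh_homD(1)[OF assms(1)] psh_homD(1)[OF assms(2)] assms(3)])
qed

lemma presheafD:
  assumes "presheaf C X"
  shows "f \<in> Mor C m n \<Longrightarrow> x \<in> el X n \<Longrightarrow> act X m n f x \<in> el X m"
    and "x \<in> el X n \<Longrightarrow> act X n n (\<lambda>p\<in>Ob C n. p) x = x"
    and "f \<in> Mor C k m \<Longrightarrow> g \<in> Mor C m n \<Longrightarrow> x \<in> el X n \<Longrightarrow>
      act X k n (compose (Ob C k) g f) x = act X k m f (act X m n g x)"
  using assms by (auto simp: presheaf_def)

lemma psh_comp_apply: "x \<in> el X n \<Longrightarrow> psh_comp X \<psi> \<phi> n x = \<psi> n (\<phi> n x)"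
  by (simp add: psh_comp_def compose_def)

lemma psh_comp_in_hom:
  assumes "presheaf C X" "\<phi> \<in> psh_hom C X Y" "\<psi> \<in> psh_hom C Y Z"
  shows "psh_comp X \<psi> \<phi> \<in> psh_hom C X Z"
proof (rule psh_homI)
  show "psh_comp X \<psi> \<phi> n \<in> extensional (el X n)" for n
    by (simp add: psh_comp_def)
qed (use assms in \<open>simp_all add: psh_comp_apply psh_homD presheafD\<close>)

text \<open>Naturality of the inverse is automatic, so that only its values have to be checked.\<close>

lemma psh_isoI:
  assumes X: "presheaf C X" and Y: "presheaf C Y" and \<phi>: "\<phi> \<in> psh_hom C X Y"
    and \<psi>: "\<And>n y. y \<in> el Y n \<Longrightarrow> \<psi> n y \<in> el X n"
    and \<psi>\<phi>: "\<And>n x. x \<in> el X n \<Longrightarrow> \<psi> n (\<phi> n x) = x"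
    and \<phi>\<psi>: "\<And>n y. y \<in> el Y n \<Longrightarrow> \<phi> n (\<psi> n y) = y"
  shows "psh_iso C X Y \<phi>"
proof -
  define \<chi> where "\<chi> n = restrict (\<psi> n) (el Y n)" for n
  have "\<chi> \<in> psh_hom C Y X"
  proof (rule psh_homI)
    fix m n f y assume f: "f \<in> Mor C m n" and y: "y \<in> el Y n"
    have "\<phi> m (act X m n f (\<psi> n y)) = act Y m n f y"
      using f y by (simp add: psh_homD(3)[OF \<phi>] \<psi> \<phi>\<psi>)
    then have "\<psi> m (act Y m n f y) = act X m n f (\<psi> n y)"
      using \<psi>\<phi>[of "act X m n f (\<psi> n y)" m] presheafD(1)[OF X f] \<psi>[OF y] by simp
    then show "\<chi> m (act Y m n f y) = act X m n f (\<chi> n y)"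
      using f y presheafD(1)[OF Y] by (simp add: \<chi>_def)
  qed (auto simp: \<chi>_def \<psi>)
  moreover have "psh_comp X \<chi> \<phi> = psh_id X" "psh_comp Y \<phi> \<chi> = psh_id Y"
    using psh_homD(2)[OF \<phi>]
    by (auto simp: psh_comp_def psh_id_def compose_def \<chi>_def \<psi>\<phi> \<phi>\<psi> fun_eq_iff restrict_def)
  ultimately show ?thesis
    using X Y \<phi> by (auto simp: psh_iso_def)
qed


section \<open>Chains in posets\<close>

abbreviation const_chain :: "nat \<Rightarrow> 'p \<Rightarrow> nat \<Rightarrow> 'p" where
  "const_chain k c \<equiv> (\<lambda>i\<in>{..k}. c)"

abbreviation id_chain :: "nat \<Rightarrow> nat \<Rightarrow> nat" where
  "id_chain k \<equiv> (\<lambda>i\<in>{..k}. i)"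

lemma mono_mapsI:
  assumes "s \<in> extensional {..k}" "\<And>i. i \<le> k \<Longrightarrow> s i \<in> P"
    "\<And>i j. i \<le> j \<Longrightarrow> j \<le> k \<Longrightarrow> le (s i) (s j)"
  shows "s \<in> mono_maps k P le"
  using assms by (auto simp: mono_maps_def PiE_def)

lemma mono_mapsD:
  assumes "s \<in> mono_maps k P le"
  shows "s \<in> extensional {..k}" "i \<le> k \<Longrightarrow> s i \<in> P"
    "i \<le> j \<Longrightarrow> j \<le> k \<Longrightarrow> le (s i) (s j)"
  using assms by (auto simp: mono_maps_def PiE_def)

definition monotone_map ::
  "'p set \<Rightarrow> ('p \<Rightarrow> 'p \<Rightarrow> bool) \<Rightarrow> 'q set \<Rightarrow> ('q \<Rightarrow> 'q \<Rightarrow> bool) \<Rightarrow> ('p \<Rightarrow> 'q) \<Rightarrow> bool" where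
  "monotone_map P le Q le' h \<longleftrightarrow> h ` P \<subseteq> Q \<and> (\<forall>x\<in>P. \<forall>y\<in>P. le x y \<longrightarrow> le' (h x) (h y))"

lemma compose_mono_maps:
  assumes "monotone_map P le Q le' h" "s \<in> mono_maps k P le"
  shows "compose {..k} h s \<in> mono_maps k Q le'"
proof (rule mono_mapsI)
  fix i j :: nat assume "i \<le> j" "j \<le> k"
  then show "le' (compose {..k} h s i) (compose {..k} h s j)"
    using assms(1) mono_mapsD(2)[OF assms(2), of i] mono_mapsD(2)[OF assms(2), of j]
      mono_mapsD(3)[OF assms(2), of i j]
    by (simp add: monotone_map_def compose_def)
qed (use assms in \<open>auto simp: monotone_map_def compose_def mono_mapsD\<close>)

lemma mono_maps_monotone:
  "s \<in> mono_maps k P le \<Longrightarrow> monotone_map {..k} (\<le>) P le s"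
  by (auto simp: monotone_map_def mono_mapsD)

lemma mono_maps_comp:
  assumes "s \<in> mono_maps k P le" "f \<in> mono_maps m {..k} (\<le>)"
  shows "compose {..m} s f \<in> mono_maps m P le"
  by (rule compose_mono_maps[OF mono_maps_monotone[OF assms(1)] assms(2)])

lemma id_chain_mono [simp]: "id_chain k \<in> mono_maps k {..k} (\<le>)"
  by (rule mono_mapsI) auto

lemma const_chain_mono [simp]: "c \<in> P \<Longrightarrow> le c c \<Longrightarrow> const_chain k c \<in> mono_maps k P le"
  by (rule mono_mapsI) auto

lemma end_chain_mono: "const_chain k (of_bool e) \<in> mono_maps k {..1::nat} (\<le>)"
  by (rule mono_mapsI) auto

lemma compose_id_chain:
  "s \<in> mono_maps k P le \<Longrightarrow> compose {..k} s (id_chain k) = s"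
  by (auto simp: compose_def fun_eq_iff restrict_def extensional_def dest: mono_mapsD(1))

lemma id_chain_compose:
  "f \<in> mono_maps m {..k} (\<le>) \<Longrightarrow> compose {..m} (id_chain k) f = f"
  using mono_mapsD(1,2)[of f m "{..k}" "(\<le>)"]
  by (auto simp: compose_def fun_eq_iff restrict_def extensional_def)

lemma compose_chain_assoc:
  "f \<in> mono_maps m {..k} le \<Longrightarrow> compose {..m} h (compose {..m} s f) = compose {..m} (compose {..k} h s) f"
  using mono_mapsD(2)[of f m "{..k}" le]
  by (auto simp: compose_def fun_eq_iff restrict_def)

text \<open>The simplicial set \<open>\<Delta>\<^sup>0\<close> is terminal.\<close>

lemma mono_maps_point:
  "t \<in> mono_maps k {..0::nat} le \<longleftrightarrow> t = const_chain k 0 \<and> le 0 0"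
proof
  assume t: "t \<in> mono_maps k {..0::nat} le"
  have "t i = const_chain k 0 i" for i
    using mono_mapsD(1)[OF t] mono_mapsD(2)[OF t, of i]
    by (cases "i \<le> k") (auto simp: extensional_def)
  then show "t = const_chain k 0 \<and> le 0 0"
    using mono_mapsD(3)[OF t, of 0 0] mono_mapsD(2)[OF t, of 0] by (auto simp: fun_eq_iff)
qed auto

lemma Simp_cat_simps [simp]:
  "Ob Simp_cat n = {..n}" "Mor Simp_cat m n = mono_maps m {..n} (\<le>)"
  by (simp_all add: Simp_cat_def)

lemma nerve_simps [simp]:
  "el (nerve P le) k = mono_maps k P le" "act (nerve P le) m k f s = compose {..m} s f"
  by (simp_all add: nerve_def)

lemma simplex_simps [simp]:
  "el (simplex n) k = mono_maps k {..n} (\<le>)" "act (simplex n) m k f s = compose {..m} s f"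
  by (simp_all add: simplex_def)

lemma T_cube_simps [simp]:
  "el (T_cube n) k = mono_maps k (cube n) cube_le" "act (T_cube n) m k f s = compose {..m} s f"
  by (simp_all add: T_cube_def)

lemma psh_prod_simps [simp]:
  "el (psh_prod X Y) k = el X k \<times> el Y k"
  "act (psh_prod X Y) m k f (x, y) = (act X m k f x, act Y m k f y)"
  by (simp_all add: psh_prod_def)

lemma presheaf_nerve: "presheaf Simp_cat (nerve P le)"
  by (auto simp: presheaf_def mono_maps_comp compose_id_chain compose_chain_assoc)

lemma presheaf_simplex: "presheaf Simp_cat (simplex n)"
  by (simp add: simplex_def presheaf_nerve)

lemma presheaf_T_cube: "presheaf Simp_cat (T_cube n)"
  by (simp add: T_cube_def presheaf_nerve)

lemma presheaf_prod:
  assumes "presheaf C X" "presheaf C Y"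
  shows "presheaf C (psh_prod X Y)"
  using assms by (auto simp: presheaf_def)

lemma nerve_map_apply:
  "s \<in> mono_maps k P le \<Longrightarrow> nerve_map P le h k s = compose {..k} h s"
  by (simp add: nerve_map_def)

lemma nerve_map_in_hom:
  assumes "monotone_map P le Q le' h"
  shows "nerve_map P le h \<in> psh_hom Simp_cat (nerve P le) (nerve Q le')"
  using assms
  by (intro psh_homI)
    (auto simp: nerve_map_def compose_mono_maps mono_maps_comp compose_chain_assoc)


section \<open>The cube as a cylinder on its base\<close>

text \<open>
  The isomorphism \<open>[1]\<^bsup>n+1\<^esup> \<cong> [1]\<^sup>n \<times> [1]\<close> that splits off the coordinate selected by \<open>W\<close>: \<open>attach W\<close>
  is the map from the product, \<open>base W\<close> and \<open>height W\<close> are the two projections.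
\<close>

definition attach :: "side \<Rightarrow> bool list \<Rightarrow> bool \<Rightarrow> bool list" where
  "attach W c e = (case W of R \<Rightarrow> c @ [e] | L \<Rightarrow> e # c)"

definition base :: "side \<Rightarrow> bool list \<Rightarrow> bool list" where
  "base W xs = (case W of R \<Rightarrow> butlast xs | L \<Rightarrow> tl xs)"

definition height :: "side \<Rightarrow> bool list \<Rightarrow> bool" where
  "height W xs = (case W of R \<Rightarrow> last xs | L \<Rightarrow> hd xs)"

lemma base_attach [simp]: "base W (attach W c e) = c"
  and height_attach [simp]: "height W (attach W c e) = e"
  by (simp_all add: attach_def base_def height_def split: side.split)

lemma attach_in_cube [simp]: "attach W c e \<in> cube (Suc n) \<longleftrightarrow> c \<in> cube n"
  by (simp add: attach_def cube_def split: side.split)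

lemma attach_base_height: "xs \<in> cube (Suc n) \<Longrightarrow> attach W (base W xs) (height W xs) = xs"
  by (cases xs) (auto simp: attach_def base_def height_def cube_def split: side.split)

lemma base_in_cube [simp]: "xs \<in> cube (Suc n) \<Longrightarrow> base W xs \<in> cube n"
  by (auto simp: base_def cube_def split: side.split)

lemma cube_le_attach:
  "c \<in> cube n \<Longrightarrow> d \<in> cube n \<Longrightarrow> cube_le (attach W c e) (attach W d e') \<longleftrightarrow> cube_le c d \<and> e \<le> e'"
  by (auto simp: attach_def cube_def list_all2_append split: side.split)

lemma cube_le_split:
  assumes "xs \<in> cube (Suc n)" "ys \<in> cube (Suc n)"
  shows "cube_le xs ys \<longleftrightarrow> cube_le (base W xs) (base W ys) \<and> height W xs \<le> height W ys"
  using cube_le_attach[of "base W xs" n "base W ys" W "height W xs" "height W ys"] assms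
  by (simp add: attach_base_height)

lemma end_face_attach: "end_face W n e = (\<lambda>xs\<in>cube n. attach W xs e)"
  by (cases W) (auto simp: face_def attach_def cube_def fun_eq_iff restrict_def)

lemma extend_op_attach:
  "extend_op W m f = (\<lambda>xs\<in>cube (Suc m). attach W (f (base W xs)) (height W xs))"
  by (cases W) (auto simp: attach_def base_def height_def)

text \<open>
  The nerve is functorial for all monotone maps, so \<open>U X\<close> carries an action of every monotone map
  between cubes. Working with this larger class makes it immediate that \<open>extend_op W m f\<close> acts
  functorially on \<open>U X\<close>; no induction over the generators of \<open>\<box>\<close> is involved there.
\<close>

abbreviation cube_map :: "nat \<Rightarrow> nat \<Rightarrow> (bool list \<Rightarrow> bool list) \<Rightarrow> bool" where
  "cube_map m n f \<equiv> monotone_map (cube m) cube_le (cube n) cube_le f"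

lemma box_mor_cube_map: "box_mor m n f \<Longrightarrow> cube_map m n f"
proof (induction rule: box_mor.induct)
  case (ident n)
  then show ?case by (auto simp: monotone_map_def)
next
  case (face i n e)
  then show ?case
    by (auto simp: monotone_map_def cube_def Defs.face_def
        intro!: list_all2_appendI list_all2_takeI list_all2_dropI)
next
  case (degen i n)
  then show ?case
    by (auto simp: monotone_map_def cube_def Defs.degen_def
        intro!: list_all2_appendI list_all2_takeI list_all2_dropI)
next
  case (conn i n e)
  have "cube_le (Defs.conn n i e xs) (Defs.conn n i e ys)"
    if le: "cube_le xs ys" and len: "length xs = n" "length ys = n" for xs ys
  proof -
    have "xs ! (i - 1) \<le> ys ! (i - 1)" "xs ! i \<le> ys ! i"
      using conn len list_all2_nthD[OF le, of "i - 1"] list_all2_nthD[OF le, of i] by simp_all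
    then have "(if e then min (xs ! (i - 1)) (xs ! i) else max (xs ! (i - 1)) (xs ! i)) \<le>
        (if e then min (ys ! (i - 1)) (ys ! i) else max (ys ! (i - 1)) (ys ! i))"
      by (cases e) (simp_all only: if_True if_False min.mono max.mono)
    then show ?thesis
      using le len unfolding Defs.conn_def cube_def
      by (simp only: restrict_apply mem_Collect_eq simp_thms if_True)
        (intro list_all2_appendI list_all2_takeI list_all2_dropI list.rel_intros)
  qed
  moreover have "Defs.conn n i e ` cube n \<subseteq> cube (n - 1)"
    using conn by (auto simp: Defs.conn_def cube_def)
  ultimately show ?case
    unfolding monotone_map_def by (simp only: cube_def mem_Collect_eq) blast
next
  case (comp k m f n g)
  then show ?case
    by (auto simp: monotone_map_def compose_def image_subset_iff)
qed

lemma cube_map_end_face: "cube_map n (Suc n) (end_face W n e)"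
  by (auto simp: monotone_map_def end_face_attach cube_le_attach)

lemma cube_map_extend_op:
  assumes "cube_map m n f"
  shows "cube_map (Suc m) (Suc n) (extend_op W m f)"
proof -
  have f: "f c \<in> cube n" if "c \<in> cube m" for c
    using assms that by (auto simp: monotone_map_def)
  have "cube_le (attach W (f (base W x)) (height W x)) (attach W (f (base W y)) (height W y))"
    if "x \<in> cube (Suc m)" "y \<in> cube (Suc m)" "cube_le x y" for x y
    using that assms cube_le_split[of x m y W]
    by (subst cube_le_attach[OF f f]) (auto simp: monotone_map_def)
  then show ?thesis
    by (auto simp: monotone_map_def extend_op_attach f)
qed

text \<open>
  The induced splitting of chains. The heights of a chain in a cube are truth values, while a simplex
  of \<open>\<Delta>\<^sup>1\<close> has values 0 and 1 in the natural numbers; the comparison with 1 and \<open>of_bool\<close> translate.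
\<close>

definition attach_chain :: "side \<Rightarrow> nat \<Rightarrow> (nat \<Rightarrow> bool list) \<Rightarrow> (nat \<Rightarrow> nat) \<Rightarrow> nat \<Rightarrow> bool list" where
  "attach_chain W k s b = (\<lambda>i\<in>{..k}. attach W (s i) (b i = 1))"

abbreviation base_chain :: "side \<Rightarrow> nat \<Rightarrow> (nat \<Rightarrow> bool list) \<Rightarrow> nat \<Rightarrow> bool list" where
  "base_chain W k s \<equiv> compose {..k} (base W) s"

abbreviation height_chain :: "side \<Rightarrow> nat \<Rightarrow> (nat \<Rightarrow> bool list) \<Rightarrow> nat \<Rightarrow> nat" where
  "height_chain W k s \<equiv> compose {..k} (\<lambda>xs. of_bool (height W xs)) s"

lemma attach_chain_mono:
  assumes s: "s \<in> mono_maps k (cube n) cube_le" and b: "b \<in> mono_maps k {..1} (\<le>)"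
  shows "attach_chain W k s b \<in> mono_maps k (cube (Suc n)) cube_le"
proof (rule mono_mapsI)
  fix i j assume "i \<le> j" "j \<le> k"
  then show "cube_le (attach_chain W k s b i) (attach_chain W k s b j)"
    using mono_mapsD(2)[OF s, of i] mono_mapsD(2)[OF s, of j] mono_mapsD(3)[OF s, of i j]
      mono_mapsD(2)[OF b, of j] mono_mapsD(3)[OF b, of i j]
    by (auto simp: attach_chain_def cube_le_attach)
qed (use mono_mapsD(2)[OF s] in \<open>auto simp: attach_chain_def\<close>)

lemma base_chain_mono:
  "s \<in> mono_maps k (cube (Suc n)) cube_le \<Longrightarrow> base_chain W k s \<in> mono_maps k (cube n) cube_le"
  by (rule compose_mono_maps) (auto simp: monotone_map_def cube_le_split[where W = W])

lemma height_chain_mono: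
  "s \<in> mono_maps k (cube (Suc n)) cube_le \<Longrightarrow> height_chain W k s \<in> mono_maps k {..1} (\<le>)"
  by (rule compose_mono_maps) (auto simp: monotone_map_def cube_le_split[where W = W])

lemma attach_chain_base_height:
  assumes "s \<in> mono_maps k (cube (Suc n)) cube_le"
  shows "attach_chain W k (base_chain W k s) (height_chain W k s) = s"
proof (rule extensionalityI[OF _ mono_mapsD(1)[OF assms]])
  fix i assume "i \<in> {..k}"
  moreover from this have "attach W (base W (s i)) (height W (s i)) = s i"
    by (simp add: attach_base_height[OF mono_mapsD(2)[OF assms]])
  ultimately show "attach_chain W k (base_chain W k s) (height_chain W k s) i = s i"
    by (cases "height W (s i)") (simp_all add: attach_chain_def compose_def)
qed (simp add: attach_chain_def)

lemma base_attach_chain: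
  "s \<in> mono_maps k (cube n) cube_le \<Longrightarrow> base_chain W k (attach_chain W k s b) = s"
  by (auto simp: attach_chain_def compose_def fun_eq_iff restrict_def extensional_def
      dest: mono_mapsD(1))

lemma height_attach_chain:
  assumes b: "b \<in> mono_maps k {..1} (\<le>)"
  shows "height_chain W k (attach_chain W k s b) = b"
  by (rule extensionalityI[OF _ mono_mapsD(1)[OF b]])
    (use mono_mapsD(2)[OF b] in \<open>auto simp: attach_chain_def compose_def le_Suc_eq\<close>)

lemma attach_chain_compose:
  "f \<in> mono_maps m {..k} (\<le>) \<Longrightarrow>
    compose {..m} (attach_chain W k s b) f = attach_chain W m (compose {..m} s f) (compose {..m} b f)"
  using mono_mapsD(2)[of f m "{..k}" "(\<le>)"]
  by (auto simp: attach_chain_def compose_def fun_eq_iff restrict_def)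

lemma compose_extend_op_attach_chain:
  assumes "s \<in> mono_maps k (cube m) cube_le"
  shows "compose {..k} (extend_op W m f) (attach_chain W k s b) =
    attach_chain W k (compose {..k} f s) b"
  using mono_mapsD(2)[OF assms]
  by (auto simp: attach_chain_def extend_op_attach compose_def fun_eq_iff restrict_def)

lemma compose_end_face_chain:
  assumes "s \<in> mono_maps k (cube n) cube_le"
  shows "compose {..k} (end_face W n e) s = attach_chain W k s (const_chain k (of_bool e))"
  using mono_mapsD(2)[OF assms]
  by (auto simp: attach_chain_def end_face_attach compose_def fun_eq_iff restrict_def)


section \<open>Cubes of \<open>U X\<close> and of its mapping spaces\<close>

lemma Box_cat_simps [simp]:
  "Ob Box_cat = cube" "f \<in> Mor Box_cat m n \<longleftrightarrow> box_mor m n f"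
  by (simp_all add: Box_cat_def)

lemma el_U [simp]: "el (U X) n = psh_hom Simp_cat (T_cube n) X"
  by (simp add: U_def)

lemma act_U_apply:
  "s \<in> mono_maps k (cube m) cube_le \<Longrightarrow> act (U X) m n f \<phi> k s = \<phi> k (compose {..k} f s)"
  by (simp add: U_def psh_comp_apply nerve_map_apply)

lemma act_U_in_hom:
  assumes "cube_map m n f" "\<phi> \<in> psh_hom Simp_cat (T_cube n) X"
  shows "act (U X) m n f \<phi> \<in> psh_hom Simp_cat (T_cube m) X"
proof -
  have "nerve_map (cube m) cube_le f \<in> psh_hom Simp_cat (T_cube m) (T_cube n)"
    using nerve_map_in_hom[OF assms(1)] by (simp add: T_cube_def)
  from psh_comp_in_hom[OF presheaf_T_cube this assms(2)] show ?thesis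
    by (simp add: U_def)
qed

lemma act_U_id:
  assumes \<phi>: "\<phi> \<in> psh_hom Simp_cat (T_cube n) X"
  shows "act (U X) n n (\<lambda>p\<in>cube n. p) \<phi> = \<phi>"
proof (rule psh_hom_eqI[OF act_U_in_hom[OF _ \<phi>] \<phi>])
  fix k s assume "s \<in> el (T_cube n) k"
  then have s: "s \<in> mono_maps k (cube n) cube_le" by simp
  have "compose {..k} (\<lambda>p\<in>cube n. p) s = s"
    by (rule extensionalityI[OF _ mono_mapsD(1)[OF s]])
      (auto simp: compose_def mono_mapsD(2)[OF s])
  then show "act (U X) n n (\<lambda>p\<in>cube n. p) \<phi> k s = \<phi> k s"
    using s by (simp add: act_U_apply)
qed (auto simp: monotone_map_def)

lemma cube_map_compose:
  assumes "cube_map k m f" "cube_map m n g"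
  shows "cube_map k n (compose (cube k) g f)"
  using assms by (auto simp: monotone_map_def compose_def image_subset_iff)

lemma act_U_compose:
  assumes f: "cube_map k m f" and g: "cube_map m n g" and \<phi>: "\<phi> \<in> psh_hom Simp_cat (T_cube n) X"
  shows "act (U X) k n (compose (cube k) g f) \<phi> = act (U X) k m f (act (U X) m n g \<phi>)"
proof (rule psh_hom_eqI[OF act_U_in_hom[OF cube_map_compose[OF f g] \<phi>]
        act_U_in_hom[OF f act_U_in_hom[OF g \<phi>]]])
  fix l s assume "s \<in> el (T_cube k) l"
  then have s: "s \<in> mono_maps l (cube k) cube_le" by simp
  have "compose {..l} (compose (cube k) g f) s = compose {..l} g (compose {..l} f s)"
    using mono_mapsD(2)[OF s] by (auto simp: compose_def fun_eq_iff restrict_def)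
  then show "act (U X) k n (compose (cube k) g f) \<phi> l s = act (U X) k m f (act (U X) m n g \<phi>) l s"
    using s by (simp add: act_U_apply compose_mono_maps[OF f])
qed

lemma presheaf_U: "presheaf Box_cat (U X)"
  by (simp add: presheaf_def act_U_in_hom act_U_id act_U_compose box_mor_cube_map)

lemma cube_map_to_point: "cube_map n 0 (\<lambda>xs\<in>cube n. [])"
  by (auto simp: monotone_map_def cube_def)

lemma U_vertex_apply:
  assumes "s \<in> mono_maps k (cube 0) cube_le"
  shows "U_vertex x k s = x k (const_chain k 0)"
proof -
  have "compose {..k} (\<lambda>xs\<in>cube 0. 0::nat) s = const_chain k 0"
    using mono_mapsD(2)[OF assms] by (auto simp: compose_def fun_eq_iff restrict_def)
  then show ?thesis
    using assms by (simp add: U_vertex_def psh_comp_apply nerve_map_apply)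
qed

lemma U_vertex_in_U:
  assumes "x \<in> sset_vertices X"
  shows "U_vertex x \<in> psh_hom Simp_cat (T_cube 0) X"
proof -
  have "nerve_map (cube 0) cube_le (\<lambda>xs\<in>cube 0. 0) \<in> psh_hom Simp_cat (T_cube 0) (simplex 0)"
    unfolding T_cube_def simplex_def
    by (rule nerve_map_in_hom) (auto simp: monotone_map_def)
  from psh_comp_in_hom[OF presheaf_T_cube this] assms show ?thesis
    by (simp add: U_vertex_def sset_vertices_def)
qed

lemma degen_cube_in_U:
  "x \<in> sset_vertices X \<Longrightarrow> degen_cube (U X) n (U_vertex x) \<in> psh_hom Simp_cat (T_cube n) X"
  by (simp add: degen_cube_def act_U_in_hom[OF cube_map_to_point] U_vertex_in_U)

lemma degen_cube_apply:
  assumes "s \<in> mono_maps k (cube n) cube_le"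
  shows "degen_cube (U X) n (U_vertex x) k s = x k (const_chain k 0)"
  using assms
  by (simp add: degen_cube_def act_U_apply U_vertex_apply compose_mono_maps[OF cube_map_to_point])

text \<open>
  Both \<open>end_face W n e\<close> and the collapse \<open>[1]\<^sup>n \<rightarrow> [1]\<^sup>0\<close> act by composition with chains, so the face
  conditions can be read off on simplices: a cube of the mapping space is a simplicial map on the cylinder \<open>(\<Delta>\<^sup>1)\<^sup>n \<times> \<Delta>\<^sup>1\<close> that is constant
  on the two ends.
\<close>

lemma el_Map:
  assumes "x0 \<in> sset_vertices X" "x1 \<in> sset_vertices X"
  shows "\<theta> \<in> el (Map_cset W (U X) (U_vertex x0) (U_vertex x1)) n \<longleftrightarrow>
    \<theta> \<in> psh_hom Simp_cat (T_cube (Suc n)) X \<and>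
    (\<forall>e k. \<forall>s \<in> mono_maps k (cube n) cube_le.
      \<theta> k (attach_chain W k s (const_chain k (of_bool e))) = (if e then x1 else x0) k (const_chain k 0))"
proof -
  have end_iff: "act (U X) n (Suc n) (end_face W n e) \<theta> = degen_cube (U X) n (U_vertex x) \<longleftrightarrow>
      (\<forall>k. \<forall>s \<in> mono_maps k (cube n) cube_le.
        \<theta> k (attach_chain W k s (const_chain k (of_bool e))) = x k (const_chain k 0))" (is "?l \<longleftrightarrow> ?r")
    if \<theta>: "\<theta> \<in> psh_hom Simp_cat (T_cube (Suc n)) X" and x: "x \<in> sset_vertices X" for e x
  proof
    assume l: ?l
    show ?r
    proof (intro allI ballI)
      fix k s assume s: "s \<in> mono_maps k (cube n) cube_le"
      show "\<theta> k (attach_chain W k s (const_chain k (of_bool e))) = x k (const_chain k 0)"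
        using act_U_apply[OF s, of X "Suc n" "end_face W n e" \<theta>] degen_cube_apply[OF s, of X x]
        by (simp add: l compose_end_face_chain[OF s])
    qed
  next
    assume r: ?r
    show ?l
      by (rule psh_hom_eqI[OF act_U_in_hom[OF cube_map_end_face \<theta>] degen_cube_in_U[OF x]])
        (use r in \<open>simp add: act_U_apply degen_cube_apply compose_end_face_chain\<close>)
  qed
  show ?thesis
    using assms by (auto simp: Map_cset_def end_iff all_bool_eq)
qed

lemma act_Map: "act (Map_cset W Y y0 y1) m n f \<theta> = act Y (Suc m) (Suc n) (extend_op W m f) \<theta>"
  by (simp add: Map_cset_def)

lemma act_Map_apply:
  assumes "s \<in> mono_maps k (cube m) cube_le" "b \<in> mono_maps k {..1} (\<le>)"
  shows "act (Map_cset W (U X) y0 y1) m n f \<theta> k (attach_chain W k s b) =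
    \<theta> k (attach_chain W k (compose {..k} f s) b)"
  using assms
  by (simp add: act_Map act_U_apply attach_chain_mono compose_extend_op_attach_chain
      del: extend_op.simps)

lemma extend_op_id: "extend_op W n (\<lambda>p\<in>cube n. p) = (\<lambda>p\<in>cube (Suc n). p)"
  by (auto simp: extend_op_attach fun_eq_iff restrict_def attach_base_height)

lemma extend_op_compose:
  assumes "cube_map k m f"
  shows "extend_op W k (compose (cube k) g f) =
    compose (cube (Suc k)) (extend_op W m g) (extend_op W k f)"
  using assms
  by (auto simp: extend_op_attach fun_eq_iff restrict_def compose_def monotone_map_def image_subset_iff)

lemma presheaf_Map:
  assumes "x0 \<in> sset_vertices X" "x1 \<in> sset_vertices X"
  shows "presheaf Box_cat (Map_cset W (U X) (U_vertex x0) (U_vertex x1))" (is "presheaf _ ?M")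
  unfolding presheaf_def
proof (intro conjI allI ballI)
  fix m n f \<theta> assume f: "f \<in> Mor Box_cat m n" and \<theta>: "\<theta> \<in> el ?M n"
  then have f: "cube_map m n f" by (simp add: box_mor_cube_map)
  show "act ?M m n f \<theta> \<in> el ?M m"
    unfolding el_Map[OF assms]
  proof (intro conjI allI ballI)
    show "act ?M m n f \<theta> \<in> psh_hom Simp_cat (T_cube (Suc m)) X"
      using \<theta> by (simp add: el_Map[OF assms] act_Map act_U_in_hom[OF cube_map_extend_op[OF f]])
  next
    fix e k s assume s: "s \<in> mono_maps k (cube m) cube_le"
    show "act ?M m n f \<theta> k (attach_chain W k s (const_chain k (of_bool e))) =
        (if e then x1 else x0) k (const_chain k 0)"
      using \<theta> unfolding act_Map_apply[OF s end_chain_mono] el_Map[OF assms]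
      by (blast intro: compose_mono_maps[OF f s])
  qed
next
  fix n \<theta> assume "\<theta> \<in> el ?M n"
  then show "act ?M n n (\<lambda>p\<in>Ob Box_cat n. p) \<theta> = \<theta>"
    by (simp add: el_Map[OF assms] act_Map extend_op_id act_U_id)
next
  fix k m n f g \<theta> assume "f \<in> Mor Box_cat k m" "g \<in> Mor Box_cat m n" and \<theta>: "\<theta> \<in> el ?M n"
  then have "cube_map k m f" "cube_map m n g" by (simp_all add: box_mor_cube_map)
  with \<theta> show "act ?M k n (compose (Ob Box_cat k) g f) \<theta> = act ?M k m f (act ?M m n g \<theta>)"
    by (simp add: el_Map[OF assms] act_Map extend_op_compose act_U_compose cube_map_extend_op)
qed


section \<open>Simplices of the mapping space of a simplicial set\<close>

text \<open>A nonconstant chain in \<open>{0, 1}\<close> takes both values, so it does not lie in the boundary.\<close>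

lemma bdry_simplex_1:
  "b \<in> el (bdry_simplex 1) k \<longleftrightarrow> (\<exists>e. b = const_chain k (of_bool e))"
proof
  assume b: "b \<in> el (bdry_simplex 1) k"
  then have m: "b \<in> mono_maps k {..1} (\<le>)" and im: "b ` {..k} \<noteq> {..1}"
    by (simp_all add: bdry_simplex_def)
  have const: "b i = b 0" if "i \<le> k" for i
  proof (rule ccontr)
    assume "b i \<noteq> b 0"
    then have "b 0 = 0" "b i = 1"
      using that mono_mapsD(2)[OF m, of i] mono_mapsD(2)[OF m, of 0] mono_mapsD(3)[OF m, of 0 i]
      by auto
    moreover have "b 0 \<in> b ` {..k}" "b i \<in> b ` {..k}"
      using that by auto
    ultimately have "{0, 1} \<subseteq> b ` {..k}"
      by simp
    moreover have "b ` {..k} \<subseteq> {..1}"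
      using mono_mapsD(2)[OF m] by blast
    ultimately show False
      using im by (auto simp: atMost_Suc)
  qed
  have "b = const_chain k (b 0)"
  proof (rule extensionalityI[OF mono_mapsD(1)[OF m]])
    fix i assume "i \<in> {..k}"
    then show "b i = const_chain k (b 0) i"
      using const[of i] by simp
  qed simp
  moreover from mono_mapsD(2)[OF m, of 0] have "b 0 = of_bool False \<or> b 0 = of_bool True"
    by auto
  ultimately show "\<exists>e. b = const_chain k (of_bool e)"
    by metis
next
  assume "\<exists>e. b = const_chain k (of_bool e)"
  then obtain e where "b = const_chain k (of_bool e)" ..
  then show "b \<in> el (bdry_simplex 1) k"
    by (auto simp: bdry_simplex_def image_constant_conv atMost_Suc)
qed

text \<open>
  The pullback condition compares two maps on \<open>\<Delta>\<^sup>n \<times> \<partial>\<Delta>\<^sup>1\<close>; as \<open>\<partial>\<Delta>\<^sup>1\<close> consists of two points, it is a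
  condition on each of the two ends of \<open>\<Delta>\<^sup>n \<times> \<Delta>\<^sup>1\<close>. The component \<open>t\<close> is determined, as \<open>\<Delta>\<^sup>0\<close> is terminal.
\<close>

lemma el_Hom:
  "(t, \<phi>) \<in> el (Hom_sset X x0 x1) n \<longleftrightarrow>
    t = const_chain n 0 \<and> \<phi> \<in> psh_hom Simp_cat (psh_prod (simplex n) (simplex 1)) X \<and>
    (\<forall>e k. \<forall>a \<in> mono_maps k {..n} (\<le>).
      \<phi> k (a, const_chain k (of_bool e)) = (if e then x1 else x0) k (const_chain k 0))"
proof -
  have "vertex_pair X x0 x1 n t = exp_restrict X (simplex 1) (bdry_simplex 1) n \<phi> \<longleftrightarrow>
    (\<forall>e k. \<forall>a \<in> mono_maps k {..n} (\<le>).
      \<phi> k (a, const_chain k (of_bool e)) = (if e then x1 else x0) k (const_chain k 0))" (is "?l = ?r \<longleftrightarrow> _")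
    if t: "t = const_chain n 0" and \<phi>: "\<phi> \<in> psh_hom Simp_cat (psh_prod (simplex n) (simplex 1)) X"
  proof -
    have l: "?l k (a, b) = (if b 0 = 0 then x0 else x1) k (const_chain k 0)"
      if a: "a \<in> mono_maps k {..n} (\<le>)" and b: "b \<in> el (bdry_simplex 1) k" for k a b
    proof -
      have "compose {..k} (const_chain n (0::nat)) a = const_chain k 0"
        using mono_mapsD(2)[OF a] by (auto simp: compose_def fun_eq_iff restrict_def)
      moreover have "const_chain n (0::nat) \<in> mono_maps n {..0} (\<le>)"
        by simp
      ultimately show ?thesis
        using a b by (simp add: vertex_pair_def t)
    qed
    have r: "?r k (a, b) = \<phi> k (a, b)"
      if "a \<in> mono_maps k {..n} (\<le>)" "b \<in> el (bdry_simplex 1) k" for k a b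
      using \<phi> that by (simp add: exp_restrict_def sset_exp_def)
    \<comment> \<open>Off the domain both sides are \<open>undefined\<close>, so that equality of functions is equality on it.\<close>
    have out: "?l k p = ?r k p" if "p \<notin> mono_maps k {..n} (\<le>) \<times> el (bdry_simplex 1) k" for k p
    proof -
      have "const_chain n (0::nat) \<in> mono_maps n {..0} (\<le>)"
        by simp
      then show ?thesis
        using \<phi> that by (simp add: vertex_pair_def t exp_restrict_def sset_exp_def restrict_def)
    qed
    have "?l = ?r \<longleftrightarrow> (\<forall>k. \<forall>a \<in> mono_maps k {..n} (\<le>). \<forall>b \<in> el (bdry_simplex 1) k.
        \<phi> k (a, b) = (if b 0 = 0 then x0 else x1) k (const_chain k 0))" (is "_ \<longleftrightarrow> ?eq")
    proof
      assume eq: "?l = ?r"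
      show ?eq
      proof (intro allI ballI)
        fix k a b assume ab: "a \<in> mono_maps k {..n} (\<le>)" "b \<in> el (bdry_simplex 1) k"
        show "\<phi> k (a, b) = (if b 0 = 0 then x0 else x1) k (const_chain k 0)"
          unfolding l[OF ab, symmetric] eq r[OF ab] ..
      qed
    next
      assume eq: ?eq
      show "?l = ?r"
      proof (intro ext)
        fix k p show "?l k p = ?r k p"
        proof (cases "p \<in> mono_maps k {..n} (\<le>) \<times> el (bdry_simplex 1) k")
          case True
          then obtain a b where p: "p = (a, b)"
            and ab: "a \<in> mono_maps k {..n} (\<le>)" "b \<in> el (bdry_simplex 1) k" by blast
          from eq ab have "\<phi> k (a, b) = (if b 0 = 0 then x0 else x1) k (const_chain k 0)" by blast
          then show ?thesis
            unfolding p l[OF ab] r[OF ab] by (rule sym)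
        qed (rule out)
      qed
    qed
    also have "\<dots> \<longleftrightarrow> (\<forall>e k. \<forall>a \<in> mono_maps k {..n} (\<le>).
      \<phi> k (a, const_chain k (of_bool e)) = (if e then x1 else x0) k (const_chain k 0))" (is "_ \<longleftrightarrow> ?ends")
    proof
      assume eq: ?eq
      show ?ends
      proof (intro allI ballI)
        fix e k a assume a: "a \<in> mono_maps k {..n} (\<le>)"
        have b: "const_chain k (of_bool e) \<in> el (bdry_simplex 1) k"
          unfolding bdry_simplex_1 by blast
        show "\<phi> k (a, const_chain k (of_bool e)) = (if e then x1 else x0) k (const_chain k 0)"
          using bspec[OF bspec[OF spec[OF eq] a] b] by (cases e) simp_all
      qed
    next
      assume ends: ?ends
      show ?eq
      proof (intro allI ballI)
        fix k a b assume a: "a \<in> mono_maps k {..n} (\<le>)" and "b \<in> el (bdry_simplex 1) k"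
        then obtain e where b: "b = const_chain k (of_bool e)"
          unfolding bdry_simplex_1 by blast
        have "\<phi> k (a, b) = (if e then x1 else x0) k (const_chain k 0)"
          unfolding b using ends a by blast
        then show "\<phi> k (a, b) = (if b 0 = 0 then x0 else x1) k (const_chain k 0)"
          by (cases e) (simp_all add: b)
      qed
    qed
    finally show ?thesis .
  qed
  moreover have "t \<in> mono_maps n {..0} (\<le>) \<longleftrightarrow> t = const_chain n 0"
    by (simp add: mono_maps_point del: atMost_0)
  moreover have "el (sset_exp X (simplex 1)) n = psh_hom Simp_cat (psh_prod (simplex n) (simplex 1)) X"
    by (simp add: sset_exp_def)
  ultimately show ?thesis
    unfolding Hom_sset_def psh_pullback_def
    by (simp only: psh.simps mem_Collect_eq case_prod_conv simplex_simps) blast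
qed

lemma act_Hom_simps:
  assumes "f \<in> mono_maps m {..n} (\<le>)"
  shows "fst (act (Hom_sset X x0 x1) m n f (t, \<phi>)) = compose {..m} t f"
    "snd (act (Hom_sset X x0 x1) m n f (t, \<phi>)) =
      (\<lambda>k. \<lambda>(a, b) \<in> mono_maps k {..m} (\<le>) \<times> mono_maps k {..1} (\<le>). \<phi> k (compose {..k} f a, b))"
  using assms by (auto simp: Hom_sset_def psh_pullback_def sset_exp_def nerve_map_apply fun_eq_iff restrict_def)

text \<open>
  A map into the mapping space is determined by its values at \<open>(id, b)\<close>: by naturality the value
  at \<open>(a, b)\<close> is found after restriction along \<open>a\<close>.
\<close>

lemma
  assumes \<Psi>: "\<Psi> \<in> psh_hom Simp_cat (T_cube n) (Hom_sset X x0 x1)"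
    and s: "s \<in> mono_maps k (cube n) cube_le"
  shows fst_Hom_cube: "fst (\<Psi> k s) = const_chain k 0"
    and snd_Hom_cube: "snd (\<Psi> k s) \<in> psh_hom Simp_cat (psh_prod (simplex k) (simplex 1)) X"
    and snd_Hom_cube_end: "a \<in> mono_maps j {..k} (\<le>) \<Longrightarrow>
      snd (\<Psi> k s) j (a, const_chain j (of_bool e)) = (if e then x1 else x0) j (const_chain j 0)"
    and snd_Hom_cube_restrict: "a \<in> mono_maps j {..k} (\<le>) \<Longrightarrow> b \<in> mono_maps j {..1} (\<le>) \<Longrightarrow>
      snd (\<Psi> k s) j (a, b) = snd (\<Psi> j (compose {..j} s a)) j (id_chain j, b)"
proof -
  obtain t \<phi> where \<Psi>s: "\<Psi> k s = (t, \<phi>)"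
    by (cases "\<Psi> k s")
  then have "(t, \<phi>) \<in> el (Hom_sset X x0 x1) k"
    using psh_homD(2)[OF \<Psi>, of s k] s by simp
  note el = this[unfolded el_Hom]
  show "fst (\<Psi> k s) = const_chain k 0"
    "snd (\<Psi> k s) \<in> psh_hom Simp_cat (psh_prod (simplex k) (simplex 1)) X"
    using el unfolding \<Psi>s fst_conv snd_conv by blast+
  show "snd (\<Psi> k s) j (a, const_chain j (of_bool e)) = (if e then x1 else x0) j (const_chain j 0)"
    if "a \<in> mono_maps j {..k} (\<le>)"
    using el that unfolding \<Psi>s snd_conv by blast
  show "snd (\<Psi> k s) j (a, b) = snd (\<Psi> j (compose {..j} s a)) j (id_chain j, b)"
    if a: "a \<in> mono_maps j {..k} (\<le>)" and b: "b \<in> mono_maps j {..1} (\<le>)"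
  proof -
    have "\<Psi> j (compose {..j} s a) = act (Hom_sset X x0 x1) j k a (t, \<phi>)"
      using psh_homD(3)[OF \<Psi>, of a j k s] a s by (simp add: \<Psi>s)
    then show ?thesis
      using a b by (simp add: \<Psi>s act_Hom_simps compose_id_chain)
  qed
qed


section \<open>The exponential law\<close>

definition uncurry_cube :: "side \<Rightarrow> nat \<Rightarrow> 'a hom_el U_el \<Rightarrow> 'a U_el" where
  "uncurry_cube W n \<Psi> k = (\<lambda>s \<in> mono_maps k (cube (Suc n)) cube_le.
     snd (\<Psi> k (base_chain W k s)) k (id_chain k, height_chain W k s))"

text \<open>
  The first component \<open>const_chain k 0\<close> is the unique \<open>k\<close>-simplex of the corner \<open>\<Delta>\<^sup>0\<close> of the pullback.
\<close>

definition curry_cube :: "side \<Rightarrow> nat \<Rightarrow> 'a U_el \<Rightarrow> 'a hom_el U_el" where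
  "curry_cube W n \<theta> k = (\<lambda>s \<in> mono_maps k (cube n) cube_le.
     (const_chain k 0, \<lambda>j. \<lambda>(a, b) \<in> mono_maps j {..k} (\<le>) \<times> mono_maps j {..1} (\<le>).
        \<theta> j (attach_chain W j (compose {..j} s a) b)))"

lemma uncurry_cube_apply:
  assumes "s \<in> mono_maps k (cube n) cube_le" "b \<in> mono_maps k {..1} (\<le>)"
  shows "uncurry_cube W n \<Psi> k (attach_chain W k s b) = snd (\<Psi> k s) k (id_chain k, b)"
  using assms
  by (simp only: uncurry_cube_def restrict_apply attach_chain_mono base_attach_chain
      height_attach_chain if_True)

text \<open>
  Naturality in the simplicial direction moves a change of base simplex from \<open>s\<close> into the first
  argument of \<open>snd (\<Psi> k s)\<close>, where the naturality of this map takes over.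
\<close>

lemma uncurry_cube_in_hom:
  assumes \<Psi>: "\<Psi> \<in> psh_hom Simp_cat (T_cube n) (Hom_sset X x0 x1)"
  shows "uncurry_cube W n \<Psi> \<in> psh_hom Simp_cat (T_cube (Suc n)) X"
proof (rule psh_homI)
  show "uncurry_cube W n \<Psi> k \<in> extensional (el (T_cube (Suc n)) k)" for k
    by (simp add: uncurry_cube_def)
next
  fix k s assume "s \<in> el (T_cube (Suc n)) k"
  then have s: "s \<in> mono_maps k (cube (Suc n)) cube_le" by simp
  show "uncurry_cube W n \<Psi> k s \<in> el X k"
    using psh_homD(2)[OF snd_Hom_cube[OF \<Psi> base_chain_mono[OF s]], of "(id_chain k, height_chain W k s)" k]
      height_chain_mono[OF s] s
    by (simp add: uncurry_cube_def)
next
  fix m k f s assume "f \<in> Mor Simp_cat m k" "s \<in> el (T_cube (Suc n)) k"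
  then have f: "f \<in> mono_maps m {..k} (\<le>)" and s: "s \<in> mono_maps k (cube (Suc n)) cube_le"
    by simp_all
  let ?\<phi> = "snd (\<Psi> k (base_chain W k s))" and ?b = "height_chain W k s"
  have b: "?b \<in> mono_maps k {..1} (\<le>)"
    by (rule height_chain_mono[OF s])
  have "uncurry_cube W n \<Psi> m (compose {..m} s f) =
      snd (\<Psi> m (compose {..m} (base_chain W k s) f)) m (id_chain m, compose {..m} ?b f)"
    by (simp only: uncurry_cube_def restrict_apply mono_maps_comp[OF s f] if_True compose_chain_assoc[OF f])
  also have "\<dots> = ?\<phi> m (f, compose {..m} ?b f)"
    by (rule snd_Hom_cube_restrict[OF \<Psi> base_chain_mono[OF s] f mono_maps_comp[OF b f], symmetric])
  also have "\<dots> = ?\<phi> m (act (psh_prod (simplex k) (simplex 1)) m k f (id_chain k, ?b))"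
    by (simp only: psh_prod_simps simplex_simps id_chain_compose[OF f])
  also have "\<dots> = act X m k f (?\<phi> k (id_chain k, ?b))"
    by (rule psh_homD(3)[OF snd_Hom_cube[OF \<Psi> base_chain_mono[OF s]]])
      (use f b in \<open>simp_all only: Simp_cat_simps psh_prod_simps simplex_simps mem_Sigma_iff id_chain_mono simp_thms\<close>)
  also have "?\<phi> k (id_chain k, ?b) = uncurry_cube W n \<Psi> k s"
    using s by (simp add: uncurry_cube_def)
  finally show "uncurry_cube W n \<Psi> m (act (T_cube (Suc n)) m k f s) = act X m k f (uncurry_cube W n \<Psi> k s)"
    by simp
qed

lemma uncurry_cube_in_Map:
  assumes \<Psi>: "\<Psi> \<in> psh_hom Simp_cat (T_cube n) (Hom_sset X x0 x1)"
    and x: "x0 \<in> sset_vertices X" "x1 \<in> sset_vertices X"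
  shows "uncurry_cube W n \<Psi> \<in> el (Map_cset W (U X) (U_vertex x0) (U_vertex x1)) n"
  unfolding el_Map[OF x]
proof (intro conjI allI ballI uncurry_cube_in_hom[OF \<Psi>])
  fix e k s assume s: "s \<in> mono_maps k (cube n) cube_le"
  show "uncurry_cube W n \<Psi> k (attach_chain W k s (const_chain k (of_bool e))) =
      (if e then x1 else x0) k (const_chain k 0)"
    by (simp only: uncurry_cube_apply[OF s end_chain_mono] snd_Hom_cube_end[OF \<Psi> s id_chain_mono])
qed

lemma curry_cube_apply:
  assumes "s \<in> mono_maps k (cube n) cube_le" "a \<in> mono_maps j {..k} (\<le>)" "b \<in> mono_maps j {..1} (\<le>)"
  shows "snd (curry_cube W n \<theta> k s) j (a, b) = \<theta> j (attach_chain W j (compose {..j} s a) b)"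
  using assms by (simp add: curry_cube_def)

text \<open>
  There are two naturalities to check. In the simplex \<open>(a, b)\<close> it comes from that of \<open>\<theta>\<close>, because
  splitting a chain commutes with reindexing; in \<open>s\<close> it is associativity of composition.
\<close>

lemma curry_cube_in_U:
  assumes x: "x0 \<in> sset_vertices X" "x1 \<in> sset_vertices X"
    and \<theta>: "\<theta> \<in> el (Map_cset W (U X) (U_vertex x0) (U_vertex x1)) n"
  shows "curry_cube W n \<theta> \<in> psh_hom Simp_cat (T_cube n) (Hom_sset X x0 x1)"
proof (rule psh_homI)
  show "curry_cube W n \<theta> k \<in> extensional (el (T_cube n) k)" for k
    by (simp add: curry_cube_def)
next
  have \<theta>_hom: "\<theta> \<in> psh_hom Simp_cat (T_cube (Suc n)) X"
    and \<theta>_end: "\<And>e k s. s \<in> mono_maps k (cube n) cube_le \<Longrightarrow>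
      \<theta> k (attach_chain W k s (const_chain k (of_bool e))) = (if e then x1 else x0) k (const_chain k 0)"
    using \<theta> unfolding el_Map[OF x] by blast+
  fix k s assume "s \<in> el (T_cube n) k"
  then have s: "s \<in> mono_maps k (cube n) cube_le" by simp
  define \<phi> where "\<phi> = snd (curry_cube W n \<theta> k s)"
  have \<phi>_apply: "\<phi> j (a, b) = \<theta> j (attach_chain W j (compose {..j} s a) b)"
    if "a \<in> mono_maps j {..k} (\<le>)" "b \<in> mono_maps j {..1} (\<le>)" for j a b
    unfolding \<phi>_def by (rule curry_cube_apply[OF s that])
  have "\<phi> \<in> psh_hom Simp_cat (psh_prod (simplex k) (simplex 1)) X"
  proof (rule psh_homI)
    show "\<phi> j \<in> extensional (el (psh_prod (simplex k) (simplex 1)) j)" for j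
      using s by (simp add: \<phi>_def curry_cube_def)
  next
    fix j p assume "p \<in> el (psh_prod (simplex k) (simplex 1)) j"
    then obtain a b where p: "p = (a, b)"
      and a: "a \<in> mono_maps j {..k} (\<le>)" and b: "b \<in> mono_maps j {..1} (\<le>)"
      by auto
    show "\<phi> j p \<in> el X j"
      unfolding p \<phi>_apply[OF a b]
      by (rule psh_homD(2)[OF \<theta>_hom]) (simp only: T_cube_simps attach_chain_mono[OF mono_maps_comp[OF s a] b])
  next
    fix i j f p assume "f \<in> Mor Simp_cat i j" "p \<in> el (psh_prod (simplex k) (simplex 1)) j"
    then obtain a b where p: "p = (a, b)" and f: "f \<in> mono_maps i {..j} (\<le>)"
      and a: "a \<in> mono_maps j {..k} (\<le>)" and b: "b \<in> mono_maps j {..1} (\<le>)"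
      by auto
    have "\<phi> i (compose {..i} a f, compose {..i} b f) =
        \<theta> i (compose {..i} (attach_chain W j (compose {..j} s a) b) f)"
      by (simp only: \<phi>_apply mono_maps_comp[OF a f] mono_maps_comp[OF b f]
          attach_chain_compose[OF f] compose_chain_assoc[OF f])
    also have "\<dots> = act X i j f (\<theta> j (attach_chain W j (compose {..j} s a) b))"
      using psh_homD(3)[OF \<theta>_hom, of f i j] f attach_chain_mono[OF mono_maps_comp[OF s a] b]
      by simp
    finally show "\<phi> i (act (psh_prod (simplex k) (simplex 1)) i j f p) = act X i j f (\<phi> j p)"
      by (simp only: p psh_prod_simps simplex_simps \<phi>_apply[OF a b])
  qed
  moreover have "\<phi> j (a, const_chain j (of_bool e)) = (if e then x1 else x0) j (const_chain j 0)"
    if "a \<in> mono_maps j {..k} (\<le>)" for e j a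
    by (simp only: \<phi>_apply[OF that end_chain_mono] \<theta>_end[OF mono_maps_comp[OF s that]])
  ultimately have "(const_chain k 0, \<phi>) \<in> el (Hom_sset X x0 x1) k"
    unfolding el_Hom by blast
  moreover have "curry_cube W n \<theta> k s = (const_chain k 0, \<phi>)"
    using s by (simp add: \<phi>_def curry_cube_def)
  ultimately show "curry_cube W n \<theta> k s \<in> el (Hom_sset X x0 x1) k"
    by simp
next
  fix m k f s assume "f \<in> Mor Simp_cat m k" "s \<in> el (T_cube n) k"
  then have f: "f \<in> mono_maps m {..k} (\<le>)" and s: "s \<in> mono_maps k (cube n) cube_le"
    by simp_all
  have pair: "curry_cube W n \<theta> k s = (const_chain k 0, snd (curry_cube W n \<theta> k s))"
    using s by (simp add: curry_cube_def)
  have "snd (curry_cube W n \<theta> m (compose {..m} s f)) =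
      snd (act (Hom_sset X x0 x1) m k f (curry_cube W n \<theta> k s))"
  proof (intro ext)
    fix j p
    show "snd (curry_cube W n \<theta> m (compose {..m} s f)) j p =
        snd (act (Hom_sset X x0 x1) m k f (curry_cube W n \<theta> k s)) j p"
    proof (cases "p \<in> mono_maps j {..m} (\<le>) \<times> mono_maps j {..1} (\<le>)")
      case True
      then obtain a b where p: "p = (a, b)"
        and a: "a \<in> mono_maps j {..m} (\<le>)" and b: "b \<in> mono_maps j {..1} (\<le>)"
        by auto
      have "snd (act (Hom_sset X x0 x1) m k f (curry_cube W n \<theta> k s)) j p =
          snd (curry_cube W n \<theta> k s) j (compose {..j} f a, b)"
        unfolding p by (subst pair, subst act_Hom_simps(2)[OF f]) (use a b in simp)
      also have "\<dots> = snd (curry_cube W n \<theta> m (compose {..m} s f)) j p"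
        by (simp only: p curry_cube_apply[OF s mono_maps_comp[OF f a] b]
            curry_cube_apply[OF mono_maps_comp[OF s f] a b] compose_chain_assoc[OF a])
      finally show ?thesis ..
    next
      case False
      then show ?thesis
        using mono_maps_comp[OF s f]
        by (subst pair, subst act_Hom_simps(2)[OF f]) (simp add: curry_cube_def)
    qed
  qed
  moreover have "fst (curry_cube W n \<theta> m (compose {..m} s f)) =
      fst (act (Hom_sset X x0 x1) m k f (curry_cube W n \<theta> k s))"
  proof -
    have "compose {..m} (const_chain k 0) f = const_chain m (0::nat)"
      using mono_mapsD(2)[OF f] by (auto simp: compose_def fun_eq_iff restrict_def)
    then show ?thesis
      using mono_maps_comp[OF s f] by (subst pair, subst act_Hom_simps(1)[OF f]) (simp add: curry_cube_def)
  qed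
  ultimately show "curry_cube W n \<theta> m (act (T_cube n) m k f s) =
      act (Hom_sset X x0 x1) m k f (curry_cube W n \<theta> k s)"
    by (simp add: prod_eq_iff)
qed

text \<open>
  The Yoneda argument: after transposing twice, the value at \<open>(a, b)\<close> is that of the restriction along
  \<open>a\<close> at \<open>(id, b)\<close>.
\<close>

lemma curry_uncurry_cube:
  assumes x: "x0 \<in> sset_vertices X" "x1 \<in> sset_vertices X"
    and \<Psi>: "\<Psi> \<in> psh_hom Simp_cat (T_cube n) (Hom_sset X x0 x1)"
  shows "curry_cube W n (uncurry_cube W n \<Psi>) = \<Psi>"
proof (rule psh_hom_eqI[OF curry_cube_in_U[OF x uncurry_cube_in_Map[OF \<Psi> x]] \<Psi>])
  fix k s assume "s \<in> el (T_cube n) k"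
  then have s: "s \<in> mono_maps k (cube n) cube_le" by simp
  have "snd (curry_cube W n (uncurry_cube W n \<Psi>) k s) = snd (\<Psi> k s)"
  proof (rule psh_hom_eqI[OF snd_Hom_cube[OF curry_cube_in_U[OF x uncurry_cube_in_Map[OF \<Psi> x]] s]
        snd_Hom_cube[OF \<Psi> s]])
    fix j p assume "p \<in> el (psh_prod (simplex k) (simplex 1)) j"
    then obtain a b where p: "p = (a, b)"
      and a: "a \<in> mono_maps j {..k} (\<le>)" and b: "b \<in> mono_maps j {..1} (\<le>)"
      by auto
    show "snd (curry_cube W n (uncurry_cube W n \<Psi>) k s) j p = snd (\<Psi> k s) j p"
      by (simp only: p curry_cube_apply[OF s a b] uncurry_cube_apply[OF mono_maps_comp[OF s a] b]
          snd_Hom_cube_restrict[OF \<Psi> s a b])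
  qed
  moreover have "fst (curry_cube W n (uncurry_cube W n \<Psi>) k s) = fst (\<Psi> k s)"
    using s by (simp add: fst_Hom_cube[OF \<Psi>] curry_cube_def)
  ultimately show "curry_cube W n (uncurry_cube W n \<Psi>) k s = \<Psi> k s"
    by (simp add: prod_eq_iff)
qed

text \<open>In this order only the unit law \<open>s id = s\<close> and the splitting of chains are involved.\<close>

lemma uncurry_curry_cube:
  assumes x: "x0 \<in> sset_vertices X" "x1 \<in> sset_vertices X"
    and \<theta>: "\<theta> \<in> el (Map_cset W (U X) (U_vertex x0) (U_vertex x1)) n"
  shows "uncurry_cube W n (curry_cube W n \<theta>) = \<theta>"
proof (rule psh_hom_eqI[OF uncurry_cube_in_hom[OF curry_cube_in_U[OF x \<theta>]]])
  show "\<theta> \<in> psh_hom Simp_cat (T_cube (Suc n)) X"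
    using \<theta> unfolding el_Map[OF x] by blast
next
  fix k s assume "s \<in> el (T_cube (Suc n)) k"
  then have s: "s \<in> mono_maps k (cube (Suc n)) cube_le" by simp
  note base = base_chain_mono[OF s, of W] and height = height_chain_mono[OF s, of W]
  have "uncurry_cube W n (curry_cube W n \<theta>) k s =
      snd (curry_cube W n \<theta> k (base_chain W k s)) k (id_chain k, height_chain W k s)"
    using s by (simp add: uncurry_cube_def)
  also have "\<dots> = \<theta> k s"
    by (simp only: curry_cube_apply[OF base id_chain_mono height] compose_id_chain[OF base]
        attach_chain_base_height[OF s])
  finally show "uncurry_cube W n (curry_cube W n \<theta>) k s = \<theta> k s" .
qed

text \<open>
  The operator \<open>extend_op W m f\<close> is \<open>f \<times> [1]\<close> under the splitting, so on both sides \<open>f\<close> is applied to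
  the base chain and the height is kept.
\<close>

lemma uncurry_cube_natural:
  assumes f: "cube_map m n f"
    and \<Psi>: "\<Psi> \<in> psh_hom Simp_cat (T_cube n) (Hom_sset X x0 x1)"
  shows "uncurry_cube W m (act (U (Hom_sset X x0 x1)) m n f \<Psi>) =
    act (Map_cset W (U X) y0 y1) m n f (uncurry_cube W n \<Psi>)"
proof (rule psh_hom_eqI[OF uncurry_cube_in_hom[OF act_U_in_hom[OF f \<Psi>]]])
  show "act (Map_cset W (U X) y0 y1) m n f (uncurry_cube W n \<Psi>) \<in> psh_hom Simp_cat (T_cube (Suc m)) X"
    unfolding act_Map by (rule act_U_in_hom[OF cube_map_extend_op[OF f] uncurry_cube_in_hom[OF \<Psi>]])
next
  fix k s' assume "s' \<in> el (T_cube (Suc m)) k"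
  then have s': "s' \<in> mono_maps k (cube (Suc m)) cube_le" by simp
  define s b where "s = base_chain W k s'" and "b = height_chain W k s'"
  then have split: "s' = attach_chain W k s b"
    by (simp only: attach_chain_base_height[OF s'])
  have s: "s \<in> mono_maps k (cube m) cube_le" and b: "b \<in> mono_maps k {..1} (\<le>)"
    unfolding s_def b_def by (rule base_chain_mono[OF s'], rule height_chain_mono[OF s'])
  show "uncurry_cube W m (act (U (Hom_sset X x0 x1)) m n f \<Psi>) k s' =
      act (Map_cset W (U X) y0 y1) m n f (uncurry_cube W n \<Psi>) k s'"
    by (simp only: split uncurry_cube_apply[OF s b] act_U_apply[OF s] act_Map_apply[OF s b]
        uncurry_cube_apply[OF compose_mono_maps[OF f s] b])
qed


section \<open>Naturality in the simplicial set\<close>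

lemma Hom_sset_map_apply:
  assumes "(t, \<phi>) \<in> el (Hom_sset X x0 x1) n"
  shows "Hom_sset_map X x0 x1 g n (t, \<phi>) = (t, psh_comp (psh_prod (simplex n) (simplex 1)) g \<phi>)"
  using assms by (simp add: Hom_sset_map_def)

text \<open>
  The map \<open>X\<^bsup>\<Delta>\<^sup>1\<^esup> \<rightarrow> X'\<^bsup>\<Delta>\<^sup>1\<^esup>\<close> given by \<open>g\<close> respects the pullback because the composite with \<open>g\<close> is constant
  at the vertex \<open>g x\<^sub>e\<close> on the end \<open>e\<close>.
\<close>

lemma U_map_Hom_in_hom:
  assumes g: "g \<in> psh_hom Simp_cat X X'"
    and \<Psi>: "\<Psi> \<in> psh_hom Simp_cat (T_cube n) (Hom_sset X x0 x1)"
  shows "psh_comp (T_cube n) (Hom_sset_map X x0 x1 g) \<Psi> \<in> psh_hom Simp_cat (T_cube n)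
    (Hom_sset X' (psh_comp (simplex 0) g x0) (psh_comp (simplex 0) g x1))"
    (is "_ \<in> psh_hom Simp_cat _ ?H'")
proof (rule psh_homI)
  show "psh_comp (T_cube n) (Hom_sset_map X x0 x1 g) \<Psi> k \<in> extensional (el (T_cube n) k)" for k
    by (simp add: psh_comp_def)
next
  fix k s assume s: "s \<in> el (T_cube n) k"
  obtain t \<phi> where \<Psi>s: "\<Psi> k s = (t, \<phi>)"
    by (cases "\<Psi> k s")
  then have el: "(t, \<phi>) \<in> el (Hom_sset X x0 x1) k"
    using psh_homD(2)[OF \<Psi> s] by simp
  then have t: "t = const_chain k 0"
    and \<phi>: "\<phi> \<in> psh_hom Simp_cat (psh_prod (simplex k) (simplex 1)) X"
    and ends: "\<And>e j a. a \<in> mono_maps j {..k} (\<le>) \<Longrightarrow>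
      \<phi> j (a, const_chain j (of_bool e)) = (if e then x1 else x0) j (const_chain j 0)"
    unfolding el_Hom by blast+
  let ?g\<phi> = "psh_comp (psh_prod (simplex k) (simplex 1)) g \<phi>"
  have "?g\<phi> \<in> psh_hom Simp_cat (psh_prod (simplex k) (simplex 1)) X'"
    by (rule psh_comp_in_hom[OF presheaf_prod[OF presheaf_simplex presheaf_simplex] \<phi> g])
  moreover have "?g\<phi> j (a, const_chain j (of_bool e)) =
      (if e then psh_comp (simplex 0) g x1 else psh_comp (simplex 0) g x0) j (const_chain j 0)"
    if a: "a \<in> mono_maps j {..k} (\<le>)" for e j a
  proof -
    have "?g\<phi> j (a, const_chain j (of_bool e)) = g j ((if e then x1 else x0) j (const_chain j 0))"
      using a end_chain_mono[of e j]
      by (subst psh_comp_apply) (simp_all only: psh_prod_simps simplex_simps mem_Sigma_iff ends simp_thms)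
    moreover have "const_chain j (0::nat) \<in> el (simplex 0) j"
      by (simp add: mono_maps_point del: atMost_0)
    ultimately show ?thesis
      by (cases e) (simp_all only: psh_comp_apply if_True if_False)
  qed
  ultimately have "(t, ?g\<phi>) \<in> el ?H' k"
    unfolding el_Hom using t by blast
  then show "psh_comp (T_cube n) (Hom_sset_map X x0 x1 g) \<Psi> k s \<in> el ?H' k"
    by (simp only: psh_comp_apply[OF s] \<Psi>s Hom_sset_map_apply[OF el])
next
  fix m k f s assume "f \<in> Mor Simp_cat m k" and s: "s \<in> el (T_cube n) k"
  then have f: "f \<in> mono_maps m {..k} (\<le>)"
    by simp
  have sf: "act (T_cube n) m k f s \<in> el (T_cube n) m"
    using s f by (simp add: mono_maps_comp)
  obtain t \<phi> where \<Psi>s: "\<Psi> k s = (t, \<phi>)"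
    by (cases "\<Psi> k s")
  then have el: "(t, \<phi>) \<in> el (Hom_sset X x0 x1) k"
    using psh_homD(2)[OF \<Psi> s] by simp
  define \<phi>f where
    "\<phi>f = (\<lambda>j. \<lambda>(a, b) \<in> mono_maps j {..m} (\<le>) \<times> mono_maps j {..1} (\<le>). \<phi> j (compose {..j} f a, b))"
  have "\<Psi> m (act (T_cube n) m k f s) = act (Hom_sset X x0 x1) m k f (t, \<phi>)"
    using psh_homD(3)[OF \<Psi>, of f m k s] f s \<Psi>s by simp
  also have "\<dots> = (compose {..m} t f, \<phi>f)"
    by (simp only: prod_eq_iff act_Hom_simps[OF f] \<phi>f_def fst_conv snd_conv simp_thms)
  finally have \<Psi>sf: "\<Psi> m (act (T_cube n) m k f s) = (compose {..m} t f, \<phi>f)" .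
  then have elf: "(compose {..m} t f, \<phi>f) \<in> el (Hom_sset X x0 x1) m"
    using psh_homD(2)[OF \<Psi> sf] by simp
  have "psh_comp (psh_prod (simplex m) (simplex 1)) g \<phi>f =
      (\<lambda>j. \<lambda>(a, b) \<in> mono_maps j {..m} (\<le>) \<times> mono_maps j {..1} (\<le>).
        psh_comp (psh_prod (simplex k) (simplex 1)) g \<phi> j (compose {..j} f a, b))"
    by (auto simp: psh_comp_def compose_def[of "_ \<times> _"] \<phi>f_def fun_eq_iff restrict_def mono_maps_comp[OF f])
  then show "psh_comp (T_cube n) (Hom_sset_map X x0 x1 g) \<Psi> m (act (T_cube n) m k f s) =
      act ?H' m k f (psh_comp (T_cube n) (Hom_sset_map X x0 x1 g) \<Psi> k s)"
    by (simp only: psh_comp_apply[OF s] psh_comp_apply[OF sf] \<Psi>s \<Psi>sf Hom_sset_map_apply[OF el]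
        Hom_sset_map_apply[OF elf] prod_eq_iff act_Hom_simps[OF f] fst_conv snd_conv simp_thms)
qed

text \<open>
  Postcomposition with \<open>g\<close> changes only values, and \<open>uncurry_cube\<close> is an evaluation.
\<close>

lemma uncurry_cube_image:
  assumes g: "g \<in> psh_hom Simp_cat X X'"
    and \<Psi>: "\<Psi> \<in> psh_hom Simp_cat (T_cube n) (Hom_sset X x0 x1)"
  shows "uncurry_cube W n (psh_comp (T_cube n) (Hom_sset_map X x0 x1 g) \<Psi>) =
    psh_comp (T_cube (Suc n)) g (uncurry_cube W n \<Psi>)"
proof (rule psh_hom_eqI[OF uncurry_cube_in_hom[OF U_map_Hom_in_hom[OF g \<Psi>]]
        psh_comp_in_hom[OF presheaf_T_cube uncurry_cube_in_hom[OF \<Psi>] g]])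
  fix k s' assume el: "s' \<in> el (T_cube (Suc n)) k"
  then have s': "s' \<in> mono_maps k (cube (Suc n)) cube_le" by simp
  define s b where "s = base_chain W k s'" and "b = height_chain W k s'"
  have s: "s \<in> el (T_cube n) k" and b: "b \<in> mono_maps k {..1} (\<le>)"
    unfolding s_def b_def T_cube_simps by (rule base_chain_mono[OF s'], rule height_chain_mono[OF s'])
  have val: "uncurry_cube W n \<Xi> k s' = snd (\<Xi> k s) k (id_chain k, b)" for \<Xi> :: "'c hom_el U_el"
    using s' by (simp add: uncurry_cube_def s_def b_def)
  have pt: "(id_chain k, b) \<in> el (psh_prod (simplex k) (simplex 1)) k"
    by (simp only: psh_prod_simps simplex_simps mem_Sigma_iff id_chain_mono b simp_thms)
  obtain t \<phi> where \<Psi>s: "\<Psi> k s = (t, \<phi>)"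
    by (cases "\<Psi> k s")
  then have "(t, \<phi>) \<in> el (Hom_sset X x0 x1) k"
    using psh_homD(2)[OF \<Psi> s] by simp
  then show "uncurry_cube W n (psh_comp (T_cube n) (Hom_sset_map X x0 x1 g) \<Psi>) k s' =
      psh_comp (T_cube (Suc n)) g (uncurry_cube W n \<Psi>) k s'"
    by (simp only: val psh_comp_apply[OF s] psh_comp_apply[OF el] \<Psi>s Hom_sset_map_apply snd_conv
        psh_comp_apply[OF pt])
qed

theorem lemma7p22:
  fixes W :: side
  shows "\<exists>\<Phi> :: 'a sset \<Rightarrow> (nat \<Rightarrow> (nat \<Rightarrow> nat) \<Rightarrow> 'a) \<Rightarrow> (nat \<Rightarrow> (nat \<Rightarrow> nat) \<Rightarrow> 'a) \<Rightarrow>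
             nat \<Rightarrow> 'a hom_el U_el \<Rightarrow> 'a U_el.
    (\<forall>X x0 x1. presheaf Simp_cat X \<and> x0 \<in> sset_vertices X \<and> x1 \<in> sset_vertices X \<longrightarrow>
       psh_iso Box_cat (U (Hom_sset X x0 x1)) (Map_cset W (U X) (U_vertex x0) (U_vertex x1))
         (\<Phi> X x0 x1)) \<and>
    (\<forall>X X' g x0 x1. presheaf Simp_cat X \<and> presheaf Simp_cat X' \<and> g \<in> psh_hom Simp_cat X X' \<and>
       x0 \<in> sset_vertices X \<and> x1 \<in> sset_vertices X \<longrightarrow>
       psh_comp (U (Hom_sset X x0 x1))
           (\<Phi> X' (psh_comp (simplex 0) g x0) (psh_comp (simplex 0) g x1))
           (U_map (Hom_sset X x0 x1) (Hom_sset_map X x0 x1 g)) =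
       psh_comp (U (Hom_sset X x0 x1))
           (Map_cset_map W (U X) (U_vertex x0) (U_vertex x1) (U_map X g))
           (\<Phi> X x0 x1))"
proof -
  define \<Phi> :: "'a sset \<Rightarrow> (nat \<Rightarrow> (nat \<Rightarrow> nat) \<Rightarrow> 'a) \<Rightarrow> (nat \<Rightarrow> (nat \<Rightarrow> nat) \<Rightarrow> 'a) \<Rightarrow>
      nat \<Rightarrow> 'a hom_el U_el \<Rightarrow> 'a U_el"
    where "\<Phi> X x0 x1 n = restrict (uncurry_cube W n) (el (U (Hom_sset X x0 x1)) n)" for X x0 x1 n
  have iso: "psh_iso Box_cat (U (Hom_sset X x0 x1)) (Map_cset W (U X) (U_vertex x0) (U_vertex x1)) (\<Phi> X x0 x1)"
    if x: "x0 \<in> sset_vertices X" "x1 \<in> sset_vertices X" for X x0 x1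
  proof (rule psh_isoI[OF presheaf_U presheaf_Map[OF x], where \<psi> = "curry_cube W"])
    show "\<Phi> X x0 x1 \<in> psh_hom Box_cat (U (Hom_sset X x0 x1)) (Map_cset W (U X) (U_vertex x0) (U_vertex x1))"
      by (rule psh_homI)
        (simp_all add: \<Phi>_def uncurry_cube_in_Map x uncurry_cube_natural box_mor_cube_map act_U_in_hom)
  qed (simp_all add: \<Phi>_def curry_cube_in_U[OF x] curry_uncurry_cube[OF x] uncurry_curry_cube[OF x])
  have natural: "psh_comp (U (Hom_sset X x0 x1))
      (\<Phi> X' (psh_comp (simplex 0) g x0) (psh_comp (simplex 0) g x1))
      (U_map (Hom_sset X x0 x1) (Hom_sset_map X x0 x1 g)) =
    psh_comp (U (Hom_sset X x0 x1))
      (Map_cset_map W (U X) (U_vertex x0) (U_vertex x1) (U_map X g)) (\<Phi> X x0 x1)"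
    if g: "g \<in> psh_hom Simp_cat X X'" and x: "x0 \<in> sset_vertices X" "x1 \<in> sset_vertices X"
    for X X' g x0 x1
  proof
    fix n
    show "psh_comp (U (Hom_sset X x0 x1))
        (\<Phi> X' (psh_comp (simplex 0) g x0) (psh_comp (simplex 0) g x1))
        (U_map (Hom_sset X x0 x1) (Hom_sset_map X x0 x1 g)) n =
      psh_comp (U (Hom_sset X x0 x1))
        (Map_cset_map W (U X) (U_vertex x0) (U_vertex x1) (U_map X g)) (\<Phi> X x0 x1) n"
      unfolding psh_comp_def[of "U _"]
    proof (rule extensionalityI[OF compose_extensional compose_extensional])
      fix \<Psi> assume el: "\<Psi> \<in> el (U (Hom_sset X x0 x1)) n"
      then have \<Psi>: "\<Psi> \<in> psh_hom Simp_cat (T_cube n) (Hom_sset X x0 x1)"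
        by simp
      show "compose (el (U (Hom_sset X x0 x1)) n)
          (\<Phi> X' (psh_comp (simplex 0) g x0) (psh_comp (simplex 0) g x1) n)
          (U_map (Hom_sset X x0 x1) (Hom_sset_map X x0 x1 g) n) \<Psi> =
        compose (el (U (Hom_sset X x0 x1)) n)
          (Map_cset_map W (U X) (U_vertex x0) (U_vertex x1) (U_map X g) n) (\<Phi> X x0 x1 n) \<Psi>"
        unfolding compose_eq[OF el]
        by (simp add: \<Phi>_def U_map_def Map_cset_map_def \<Psi> U_map_Hom_in_hom[OF g \<Psi>]
            uncurry_cube_image[OF g \<Psi>] uncurry_cube_in_Map[OF \<Psi> x] uncurry_cube_in_hom[OF \<Psi>])
    qed
  qed
  show ?thesis
    by (rule exI[of _ \<Phi>]) (use iso natural in blast)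
qed

end
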